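(* Let $(\beta,\mu)\in\mathbb{B}\times\mathbb{P}$, where both sets are compact. Assume that the weight $\Lambda$ in $h_\Lambda(s,t)=\int f_{\beta,\mu}(s,t)\,d\Lambda(\beta,\mu)$ has full support on $\mathbb{B}\times\mathbb{P}$. Then there exists a sequence of Bayes tests $\phi_m(s,t)$ which converges weakly (in the weak* topology on $\mathcal{L}_\infty(\mathbb{R}^{2k})$) to the WAP unbiased test. In particular, the WAP unbiased test is admissible.
   Context: Fix $k\ge1$, $\beta_0\in\mathbb{R}$, $\alpha\in(0,1)$ and a symmetric positive definite $2k\times 2k$ matrix $\Sigma$. For $\beta\in\mathbb{R}$ write $a=(\beta,1)'$, $a_0=(\beta_0,1)'$, $b_0=(1,-\beta_0)'$. Define $$C_{\beta_0}=[(b_0'\otimes I_k)\Sigma(b_0\otimes I_k)]^{-1/2},\qquad D_\beta=[(a_0'\otimes I_k)\Sigma^{-1}(a_0\otimes I_k)]^{-1/2}(a_0'\otimes I_k)\Sigma^{-1}(a\otimes I_k).$$ $f_{\beta,\mu}(s,t)$ is the joint density on $\mathbb{R}^k\times\mathbb{R}^k$ of independent $S\sim N((\beta-\beta_0)C_{\beta_0}\mu,I_k)$ and $T\sim N(D_\beta\mu,I_k)$. The problem is to test $H_0:\beta=\beta_0$ against $H_1:\beta\neq\beta_0$, with $\mu$ a nuisance parameter and parameter space $\mathbb{B}\times\mathbb{P}\subset\mathbb{R}\times\mathbb{R}^k$, $\beta_0\in\mathbb{B}$. A test is a measurable function $\phi(s,t)$ with values in $[0,1]$ (its probability of rejecting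 $H_0$). Its power function is $E_{\beta,\mu}\phi(S,T)$. A (level $\alpha$) test is unbiased if $E_{\beta_0,\mu_0}\phi\le\alpha\le E_{\beta,\mu}\phi$ for all $\mu_0,\mu\in\mathbb{P}$ and all $\beta\in\mathbb{B}$, $\beta\neq\beta_0$. The WAP (weighted-average power) unbiased test is the test maximizing $E_\Lambda\phi=\int\phi(s,t)h_\Lambda(s,t)\,d(s,t)$ among unbiased tests. A Bayes test is a test of the likelihood-ratio form minimizing a weighted average of the null rejection probabilities and type II error probabilities: it rejects when $\int f_{\beta,\mu}\,d\Lambda_1(\beta,\mu)>\int f_{\beta_0,\mu}\,d\Lambda_0(\mu)$ and accepts when the reverse strict inequality holds, for finite positive measures $\Lambda_1$ on the alternative and $\Lambda_0$ on the null. A test $\phi$ is admissible if there is no test $\phi'$ with $E_{\beta_0,\mu}\phi'\le E_{\beta_0,\mu}\phi$ for all $\mu\in\mathbb{P}$ and $E_{\beta,\mu}\phi'\ge E_{\beta,\mu}\phi$ for all $(\beta,\mu)\in\mathbb{B}\times\mathbb{P}$ with $\beta\ne\beta_0$, with strict inequality at some parameter value. Weak* convergence $\phi_m\to\phi$ in $\mathcal{L}_\infty(\mathbb{R}^{2k})$ means $\int\phi_m g\to\int\phi g$ for every $g\in\mathcal{L}_1(\mathbb{R}^{2k})$.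
   Formalization: As stated the claim fails if β0 is isolated in 𝔹, since full support puts weight on the null; there Λ is instead assumed to give no mass to {β0}×ℙ and to have full support on (𝔹∖{β0})×ℙ. Also 𝔹≠{β0} and ℙ nonempty are assumed. *)

theory Defs
  imports "HOL-Probability.Probability"
begin

definition pos_def :: "real^'n^'n \<Rightarrow> bool" where
  "pos_def A \<longleftrightarrow> transpose A = A \<and> (\<forall>x. x \<noteq> 0 \<longrightarrow> x \<bullet> (A *v x) > 0)"

text \<open>A^{-1/2} for positive definite A: the positive definite square root of the inverse of A.\<close>

definition inv_sqrt :: "real^'n^'n \<Rightarrow> real^'n^'n" where
  "inv_sqrt A = (THE R. pos_def R \<and> R ** R = matrix_inv A)"

text \<open>The Kronecker product of a column vector of length 2 with the identity matrix of size k.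
  The rows of this 2k by k matrix are indexed by pairs (block, position in block).\<close>

definition kron_I :: "real^2 \<Rightarrow> real^'k^(2 \<times> 'k)" where
  "kron_I v = (\<chi> p j. v $ fst p * mat 1 $ snd p $ j)"

definition a_vec :: "real \<Rightarrow> real^2" where
  "a_vec \<beta> = vector [\<beta>, 1]"

definition b_vec :: "real \<Rightarrow> real^2" where
  "b_vec \<beta> = vector [1, - \<beta>]"

definition C_mat :: "real^(2 \<times> 'k)^(2 \<times> 'k) \<Rightarrow> real \<Rightarrow> real^'k^'k" where
  "C_mat \<Sigma> \<beta>0 = inv_sqrt (transpose (kron_I (b_vec \<beta>0)) ** \<Sigma> ** kron_I (b_vec \<beta>0))"

definition D_mat :: "real^(2 \<times> 'k)^(2 \<times> 'k) \<Rightarrow> real \<Rightarrow> real \<Rightarrow> real^'k^'k" where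
  "D_mat \<Sigma> \<beta>0 \<beta> =
     inv_sqrt (transpose (kron_I (a_vec \<beta>0)) ** matrix_inv \<Sigma> ** kron_I (a_vec \<beta>0))
     ** (transpose (kron_I (a_vec \<beta>0)) ** matrix_inv \<Sigma> ** kron_I (a_vec \<beta>))"

text \<open>Density of the normal distribution with mean m and identity covariance matrix.\<close>

definition std_normal_vec_density :: "real^'k \<Rightarrow> real^'k \<Rightarrow> real" where
  "std_normal_vec_density m x = (\<Prod>i\<in>UNIV. normal_density (m $ i) 1 (x $ i))"

definition joint_density ::
  "real^(2 \<times> 'k)^(2 \<times> 'k) \<Rightarrow> real \<Rightarrow> real \<Rightarrow> real^'k \<Rightarrow> (real^'k) \<times> (real^'k) \<Rightarrow> real" where
  "joint_density \<Sigma> \<beta>0 \<beta> \<mu> = (\<lambda>(s, t).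
     std_normal_vec_density ((\<beta> - \<beta>0) *\<^sub>R (C_mat \<Sigma> \<beta>0 *v \<mu>)) s *
     std_normal_vec_density (D_mat \<Sigma> \<beta>0 \<beta> *v \<mu>) t)"

definition is_test :: "((real^'k) \<times> (real^'k) \<Rightarrow> real) \<Rightarrow> bool" where
  "is_test \<phi> \<longleftrightarrow> \<phi> \<in> borel_measurable borel \<and> (\<forall>x. 0 \<le> \<phi> x \<and> \<phi> x \<le> 1)"

definition power_fun ::
  "real^(2 \<times> 'k)^(2 \<times> 'k) \<Rightarrow> real \<Rightarrow> ((real^'k) \<times> (real^'k) \<Rightarrow> real) \<Rightarrow> real \<Rightarrow> real^'k \<Rightarrow> real" where
  "power_fun \<Sigma> \<beta>0 \<phi> \<beta> \<mu> = (LINT x|lborel. \<phi> x * joint_density \<Sigma> \<beta>0 \<beta> \<mu> x)"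

definition unbiased_test ::
  "real^(2 \<times> 'k)^(2 \<times> 'k) \<Rightarrow> real \<Rightarrow> real \<Rightarrow> real set \<Rightarrow> (real^'k) set
     \<Rightarrow> ((real^'k) \<times> (real^'k) \<Rightarrow> real) \<Rightarrow> bool" where
  "unbiased_test \<Sigma> \<beta>0 \<alpha> B P \<phi> \<longleftrightarrow> is_test \<phi> \<and>
     (\<forall>\<mu>\<in>P. power_fun \<Sigma> \<beta>0 \<phi> \<beta>0 \<mu> \<le> \<alpha>) \<and>
     (\<forall>\<beta>\<in>B. \<forall>\<mu>\<in>P. \<beta> \<noteq> \<beta>0 \<longrightarrow> \<alpha> \<le> power_fun \<Sigma> \<beta>0 \<phi> \<beta> \<mu>)"

definition finite_borel_measure_on :: "'a::topological_space set \<Rightarrow> 'a measure \<Rightarrow> bool" where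
  "finite_borel_measure_on S M \<longleftrightarrow> sets M = sets borel \<and> finite_measure M \<and> (AE x in M. x \<in> S)"

text \<open>If \<beta>0 is isolated in B, full support on B \<times> P forces positive mass on the null hypothesis, so
  that the weighted average power rewards rejecting a true null; a WAP unbiased test can then be
  inadmissible. In that case the weight is taken on the alternative only.\<close>

definition full_support_on :: "'a::topological_space set \<Rightarrow> 'a measure \<Rightarrow> bool" where
  "full_support_on S M \<longleftrightarrow> (\<forall>U. open U \<and> U \<inter> S \<noteq> {} \<longrightarrow> emeasure M U > 0)"

definition mix_density ::
  "real^(2 \<times> 'k)^(2 \<times> 'k) \<Rightarrow> real \<Rightarrow> (real \<times> (real^'k)) measure
     \<Rightarrow> (real^'k) \<times> (real^'k) \<Rightarrow> real" where
  "mix_density \<Sigma> \<beta>0 \<Lambda> x = (LINT (\<beta>, \<mu>)|\<Lambda>. joint_density \<Sigma> \<beta>0 \<beta> \<mu> x)"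

definition weighted_average_power ::
  "real^(2 \<times> 'k)^(2 \<times> 'k) \<Rightarrow> real \<Rightarrow> (real \<times> (real^'k)) measure
     \<Rightarrow> ((real^'k) \<times> (real^'k) \<Rightarrow> real) \<Rightarrow> real" where
  "weighted_average_power \<Sigma> \<beta>0 \<Lambda> \<phi> = (LINT x|lborel. \<phi> x * mix_density \<Sigma> \<beta>0 \<Lambda> x)"

definition WAP_unbiased_test ::
  "real^(2 \<times> 'k)^(2 \<times> 'k) \<Rightarrow> real \<Rightarrow> real \<Rightarrow> real set \<Rightarrow> (real^'k) set
     \<Rightarrow> (real \<times> (real^'k)) measure \<Rightarrow> ((real^'k) \<times> (real^'k) \<Rightarrow> real) \<Rightarrow> bool" where
  "WAP_unbiased_test \<Sigma> \<beta>0 \<alpha> B P \<Lambda> \<phi> \<longleftrightarrow> unbiased_test \<Sigma> \<beta>0 \<alpha> B P \<phi> \<and>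
     (\<forall>\<psi>. unbiased_test \<Sigma> \<beta>0 \<alpha> B P \<psi> \<longrightarrow>
        weighted_average_power \<Sigma> \<beta>0 \<Lambda> \<psi> \<le> weighted_average_power \<Sigma> \<beta>0 \<Lambda> \<phi>)"

text \<open>Both measures have to be nonzero: with two zero measures every test would qualify.
  Where the two mixture densities agree, the test is unrestricted.\<close>

definition bayes_test ::
  "real^(2 \<times> 'k)^(2 \<times> 'k) \<Rightarrow> real \<Rightarrow> real set \<Rightarrow> (real^'k) set
     \<Rightarrow> ((real^'k) \<times> (real^'k) \<Rightarrow> real) \<Rightarrow> bool" where
  "bayes_test \<Sigma> \<beta>0 B P \<phi> \<longleftrightarrow> is_test \<phi> \<and>
     (\<exists>\<Lambda>1 \<Lambda>0.
        finite_borel_measure_on ((B - {\<beta>0}) \<times> P) \<Lambda>1 \<and> emeasure \<Lambda>1 UNIV > 0 \<and>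
        finite_borel_measure_on P \<Lambda>0 \<and> emeasure \<Lambda>0 UNIV > 0 \<and>
        (\<forall>x. (mix_density \<Sigma> \<beta>0 \<Lambda>1 x > (LINT \<mu>|\<Lambda>0. joint_density \<Sigma> \<beta>0 \<beta>0 \<mu> x) \<longrightarrow> \<phi> x = 1) \<and>
             (mix_density \<Sigma> \<beta>0 \<Lambda>1 x < (LINT \<mu>|\<Lambda>0. joint_density \<Sigma> \<beta>0 \<beta>0 \<mu> x) \<longrightarrow> \<phi> x = 0)))"

definition admissible_test ::
  "real^(2 \<times> 'k)^(2 \<times> 'k) \<Rightarrow> real \<Rightarrow> real set \<Rightarrow> (real^'k) set
     \<Rightarrow> ((real^'k) \<times> (real^'k) \<Rightarrow> real) \<Rightarrow> bool" where
  "admissible_test \<Sigma> \<beta>0 B P \<phi> \<longleftrightarrow> is_test \<phi> \<and>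
     \<not> (\<exists>\<psi>. is_test \<psi> \<and>
          (\<forall>\<mu>\<in>P. power_fun \<Sigma> \<beta>0 \<psi> \<beta>0 \<mu> \<le> power_fun \<Sigma> \<beta>0 \<phi> \<beta>0 \<mu>) \<and>
          (\<forall>\<beta>\<in>B. \<forall>\<mu>\<in>P. \<beta> \<noteq> \<beta>0 \<longrightarrow> power_fun \<Sigma> \<beta>0 \<psi> \<beta> \<mu> \<ge> power_fun \<Sigma> \<beta>0 \<phi> \<beta> \<mu>) \<and>
          ((\<exists>\<mu>\<in>P. power_fun \<Sigma> \<beta>0 \<psi> \<beta>0 \<mu> < power_fun \<Sigma> \<beta>0 \<phi> \<beta>0 \<mu>) \<or>
           (\<exists>\<beta>\<in>B. \<exists>\<mu>\<in>P. \<beta> \<noteq> \<beta>0 \<and> power_fun \<Sigma> \<beta>0 \<psi> \<beta> \<mu> > power_fun \<Sigma> \<beta>0 \<phi> \<beta> \<mu>)))"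

definition weak_star_converges ::
  "(nat \<Rightarrow> (real^'k) \<times> (real^'k) \<Rightarrow> real) \<Rightarrow> ((real^'k) \<times> (real^'k) \<Rightarrow> real) \<Rightarrow> bool" where
  "weak_star_converges \<phi>s \<phi> \<longleftrightarrow>
     (\<forall>g. integrable lborel g \<longrightarrow>
        (\<lambda>m. LINT x|lborel. \<phi>s m x * g x) \<longlonglongrightarrow> (LINT x|lborel. \<phi> x * g x))"

end

theory Submission imports Defs begin

text \<open>
  The parameter \<open>(\<beta>, \<mu>)\<close> enters the distribution of the observation \<open>(s, t)\<close> only through the mean
  \<open>((\<beta> - \<beta>0) C \<mu>, D\<^sub>\<beta> \<mu>)\<close> of a Gaussian vector with identity covariance. This mean is continuous, and its first
  component vanishes on the null while it is nonzero for \<open>\<beta> \<noteq> \<beta>0\<close> and \<open>\<mu> \<noteq> 0\<close>, since \<open>C\<close> is a positive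
  definite matrix (\<open>pos_def_unique_square_root\<close>, \<open>C_mat_injective\<close>).

  The weight may be restricted to the alternative \<open>A = (B - {\<beta>0}) \<times> P\<close>, where it has full support. Indeed its
  part on the null contributes the same to the weighted average power of all unbiased tests: either
  this part is zero, or \<open>\<beta>0\<close> is a limit point of \<open>B\<close>, and then continuity forces an unbiased test to have
  rejection probability exactly \<open>\<alpha>\<close> on the null. This gives the abstract problem of the locale
  \<open>shift_testing\<close>, with weight \<open>L\<close>.

  Existence of maximisers and limits of tests come from one compactness principle: midpoint-convex sets of
  tests that decrease contain a sequence that converges almost everywhere
  (\<open>midpoint_convex_AE_compactness\<close>, a parallelogram argument). All functionals maximised here are concave and
  continuous along such sequences.

  Uniqueness (\<open>optimal_unique\<close>): if two optimal tests differed, their midpoint would lie strictly between 0 and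
  1 on a bounded set of positive measure. Take a direction \<open>v = (C \<mu>, 0)\<close> with \<open>\<mu> \<noteq> 0\<close>. On that set the
  midpoint can be perturbed by a second difference in direction \<open>v\<close>. Gaussian densities with different
  means are exponential tilts of each other, and the exponential is convex; so the perturbation
  leaves the null powers unchanged, lowers no power on the alternative, and raises the average power.

  Bayes tests: let \<open>\<phi>\<^sub>n\<close> maximise, over all tests, the average power minus \<open>n / 2\<close> times the integral over \<open>L\<close> of
  the squared violations of the unbiasedness constraints. The first order condition says that \<open>\<phi>\<^sub>n\<close> is a
  likelihood-ratio test, whose measures have the densities \<open>1 + n\<close> times the violation on the alternative
  and \<open>n\<close> times the violation on the null (\<open>bayes_penalised_maximiser_exists\<close>). Since the penalty of
  \<open>\<phi>\<^sub>n\<close> is of order \<open>1 / n\<close> and its average power is at least the optimal one, every limit is an optimal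
  unbiased test, and by uniqueness it is the given one (\<open>penalised_maximisers_converge\<close>).

  Admissibility: a test that dominates the optimal one is unbiased and has at least its average power, so by
  uniqueness the two agree almost everywhere and have equal powers.

  The case \<open>P = {0}\<close>, in which no such direction \<open>v\<close> exists, is degenerate: all the distributions coincide.
\<close>

section \<open>Positive definite square roots\<close>

text \<open>A maximiser \<open>v\<close> of \<open>u \<bullet> f u\<close> over the unit sphere of \<open>V\<close> is an eigenvector: the quadratic form
  \<open>c * (u \<bullet> u) - u \<bullet> f u\<close>, with \<open>c\<close> the maximum, is nonnegative on \<open>V\<close> and vanishes at \<open>v\<close>, so its derivative at
  \<open>v\<close> in the direction \<open>f v - c *\<^sub>R v\<close> has to vanish.\<close>

lemma self_adjoint_has_eigenvector:
  fixes f :: "'a::euclidean_space \<Rightarrow> 'a"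
  assumes lin: "linear f" and sym: "\<And>x y. f x \<bullet> y = x \<bullet> f y"
    and V: "subspace V" "V \<noteq> {0}" "f ` V \<subseteq> V"
  shows "\<exists>v\<in>V. norm v = 1 \<and> (\<exists>c. f v = c *\<^sub>R v)"
proof -
  let ?S = "V \<inter> sphere 0 1"
  obtain x where x: "x \<in> V" "x \<noteq> 0" using V subspace_0 by blast
  have ne: "?S \<noteq> {}"
  proof -
    have "x /\<^sub>R norm x \<in> ?S" using x V by (simp add: subspace_scale)
    then show ?thesis by blast
  qed
  have "compact ?S" by (simp add: V(1) closed_Int_compact closed_subspace)
  moreover have "continuous_on ?S (\<lambda>v. v \<bullet> f v)"
    by (intro continuous_intros linear_continuous_on linear_conv_bounded_linear[THEN iffD1] lin)
  ultimately obtain v where v: "v \<in> ?S" and mx: "\<And>u. u \<in> ?S \<Longrightarrow> u \<bullet> f u \<le> v \<bullet> f v"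
    using continuous_attains_sup[OF _ ne] by blast
  define c where "c = v \<bullet> f v"
  have vV: "v \<in> V" "norm v = 1" "v \<bullet> v = 1" using v by (auto simp: dot_square_norm)
  have nonneg: "0 \<le> c * (u \<bullet> u) - u \<bullet> f u" if "u \<in> V" for u
  proof (cases "u = 0")
    case True then show ?thesis using lin by (simp add: linear_0)
  next
    case False
    have "u /\<^sub>R norm u \<in> ?S" using that False V by (simp add: subspace_scale)
    from mx[OF this] have "(u \<bullet> f u) / (norm u)\<^sup>2 \<le> c"
      by (simp add: linear_scale[OF lin] c_def power2_eq_square divide_inverse mult_ac)
    then show ?thesis using False by (simp add: pos_divide_le_eq dot_square_norm)
  qed
  define w where "w = f v - c *\<^sub>R v"
  have wV: "w \<in> V" unfolding w_def using V vV(1) by (auto intro!: subspace_diff subspace_scale)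
  have cross: "f v \<bullet> w = w \<bullet> w + c * (v \<bullet> w)" by (simp add: w_def inner_diff_left)
  \<comment> \<open>The form at the point v + t w; its linear term in t is twice the squared norm of w.\<close>
  have quad: "2 * t * (w \<bullet> w) \<le> t\<^sup>2 * (c * (w \<bullet> w) - w \<bullet> f w)" for t
  proof -
    have "v + t *\<^sub>R w \<in> V" using V vV wV by (simp add: subspace_add subspace_scale)
    from nonneg[OF this] have "0 \<le> c * ((v + t *\<^sub>R w) \<bullet> (v + t *\<^sub>R w)) - (v + t *\<^sub>R w) \<bullet> (f v + t *\<^sub>R f w)"
      by (simp add: linear_add[OF lin] linear_scale[OF lin])
    also have "\<dots> = t\<^sup>2 * (c * (w \<bullet> w) - w \<bullet> f w) - 2 * t * (w \<bullet> w)"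
    proof -
      have "w \<bullet> v = v \<bullet> w" "w \<bullet> f v = f v \<bullet> w" "v \<bullet> f w = f v \<bullet> w" "v \<bullet> f v = c"
        using sym[of v w] by (simp_all add: inner_commute c_def)
      then show ?thesis unfolding cross inner_add_left inner_add_right
        by (simp add: cross vV(3) power2_eq_square algebra_simps)
    qed
    finally show ?thesis by simp
  qed
  have "w \<bullet> w = 0"
  proof (rule ccontr)
    assume "w \<bullet> w \<noteq> 0"
    then have pos: "w \<bullet> w > 0" by simp
    let ?g = "c * (w \<bullet> w) - w \<bullet> f w"
    have g: "?g > 0" using quad[of 1] pos unfolding power_one mult_1 mult_1_right by linarith
    have "2 * ((w \<bullet> w) / ?g) * (w \<bullet> w) \<le> ((w \<bullet> w) / ?g)\<^sup>2 * ?g" by (rule quad)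
    also have "\<dots> = ((w \<bullet> w) / ?g) * (w \<bullet> w)" using g by (simp add: power2_eq_square)
    finally have "((w \<bullet> w) / ?g) * (w \<bullet> w) \<le> 0" by (simp only: mult.assoc)
    moreover have "((w \<bullet> w) / ?g) * (w \<bullet> w) > 0" using pos g by (intro mult_pos_pos divide_pos_pos)
    ultimately show False by linarith
  qed
  then have "f v = c *\<^sub>R v" by (simp add: w_def)
  then show ?thesis using vV by blast
qed

text \<open>The orthogonal complement of an eigenvector is invariant, which allows induction on the dimension.\<close>

lemma self_adjoint_has_eigenbasis_on:
  fixes f :: "'a::euclidean_space \<Rightarrow> 'a"
  assumes lin: "linear f" and sym: "\<And>x y. f x \<bullet> y = x \<bullet> f y"
    and "subspace V" "f ` V \<subseteq> V"
  shows "\<exists>E. finite E \<and> pairwise orthogonal E \<and> span E = V \<and>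
    (\<forall>v\<in>E. norm v = 1 \<and> (\<exists>c. f v = c *\<^sub>R v))"
  using assms(3,4)
proof (induction "dim V" arbitrary: V rule: less_induct)
  case less
  show ?case
  proof (cases "V = {0}")
    case True
    then show ?thesis by (intro exI[of _ "{}"]) auto
  next
    case False
    obtain v c where v: "v \<in> V" "norm v = 1" "f v = c *\<^sub>R v"
      using self_adjoint_has_eigenvector[OF lin sym less.prems(1) False less.prems(2)] by blast
    have vv: "v \<bullet> v = 1" using v by (simp add: dot_square_norm)
    define W where "W = V \<inter> {x. v \<bullet> x = 0}"
    have sW: "subspace W"
      unfolding W_def by (intro subspace_inter less.prems(1) subspace_hyperplane)
    have "v \<notin> W" "W \<subseteq> V" using vv by (auto simp: W_def)
    then have "W \<subset> V" using v(1) by blast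
    then have "dim W < dim V"
      using sW less.prems(1) by (metis dim_psubset span_eq_iff)
    moreover have "f ` W \<subseteq> W"
    proof
      fix y assume "y \<in> f ` W"
      then obtain x where x: "x \<in> V" "v \<bullet> x = 0" "y = f x" by (auto simp: W_def)
      then have "v \<bullet> f x = 0" using sym[of v x] v(3) by simp
      then show "y \<in> W" using x less.prems(2) by (auto simp: W_def)
    qed
    ultimately obtain E where E: "finite E" "pairwise orthogonal E" "span E = W"
      "\<forall>v\<in>E. norm v = 1 \<and> (\<exists>c. f v = c *\<^sub>R v)"
      using less.hyps[OF _ sW] by blast
    have EW: "E \<subseteq> W" using E(3) span_superset by blast
    have "pairwise orthogonal (insert v E)"
      using E(2) EW by (auto simp: pairwise_insert orthogonal_def W_def inner_commute)
    moreover have "span (insert v E) = V"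
    proof
      show "span (insert v E) \<subseteq> V"
        using EW v(1) less.prems(1) by (intro span_minimal) (auto simp: W_def)
      show "V \<subseteq> span (insert v E)"
      proof
        fix x assume "x \<in> V"
        then have "x - (v \<bullet> x) *\<^sub>R v \<in> W"
          using v(1) vv less.prems(1)
          by (auto simp: W_def inner_diff_right intro: subspace_diff subspace_scale)
        then show "x \<in> span (insert v E)" using E(3) by (auto simp: span_insert)
      qed
    qed
    ultimately show ?thesis using E v by (intro exI[of _ "insert v E"]) auto
  qed
qed

text \<open>The root acts on an orthonormal eigenbasis by the square roots of the eigenvalues. It is the only one: if
  \<open>S\<close> is a positive definite root and \<open>A *v v = c *\<^sub>R v\<close>, then \<open>w = S *v v - sqrt c *\<^sub>R v\<close> satisfies
  \<open>S *v w = - sqrt c *\<^sub>R w\<close>, which positive definiteness allows only for \<open>w = 0\<close>. Without uniqueness the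
  definite description in \<open>inv_sqrt\<close> would carry no information.\<close>

lemma pos_def_unique_square_root:
  fixes A :: "real^'n^'n"
  assumes "pos_def A"
  shows "\<exists>!R. pos_def R \<and> R ** R = A"
proof -
  have selfadj: "(S *v x) \<bullet> y = x \<bullet> (S *v y)" if "pos_def S" for S :: "real^'n^'n" and x y
    using that by (metis dot_lmul_matrix pos_def_def transpose_matrix_vector)
  obtain E where E: "finite E" "pairwise orthogonal E" "span E = (UNIV :: (real^'n) set)"
      and nrm: "\<And>v. v \<in> E \<Longrightarrow> norm v = 1" and "\<forall>v\<in>E. \<exists>c. A *v v = c *\<^sub>R v"
    using self_adjoint_has_eigenbasis_on[of "(*v) A" UNIV] selfadj[OF assms] by auto
  then obtain c where c: "\<And>v. v \<in> E \<Longrightarrow> A *v v = c v *\<^sub>R v" by metis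
  have ev: "(\<Sum>v\<in>E. (v \<bullet> x) *\<^sub>R v) = x" for x
    using orthonormal_basis_expand[OF E(2) nrm _ E(1), of x] E(3) by (simp add: inner_commute)
  have vv: "v \<bullet> v = 1" if "v \<in> E" for v using nrm[OF that] by (simp add: dot_square_norm)
  have c_pos: "c v > 0" if "v \<in> E" for v
  proof -
    have "v \<noteq> 0" using vv[OF that] by auto
    then have "v \<bullet> (A *v v) > 0" using assms by (simp add: pos_def_def)
    then show ?thesis using c[OF that] vv[OF that] by simp
  qed
  define r where "r x = (\<Sum>v\<in>E. (sqrt (c v) * (v \<bullet> x)) *\<^sub>R v)" for x
  have "linear r"
    unfolding r_def
    by (rule linearI) (simp_all add: inner_add_right algebra_simps sum.distrib scaleR_sum_right)
  define R where "R = matrix r"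
  have Rr: "R *v x = r x" for x unfolding R_def using matrix_vector_mul(2)[OF \<open>linear r\<close>] by (rule fun_cong)
  have vr: "v \<bullet> r x = sqrt (c v) * (v \<bullet> x)" if "v \<in> E" for v x
  proof -
    have "v \<bullet> r x = (\<Sum>u\<in>E. if u = v then sqrt (c v) * (v \<bullet> x) else 0)"
      unfolding r_def inner_sum_right
    proof (rule sum.cong)
      fix u assume "u \<in> E"
      then show "v \<bullet> ((sqrt (c u) * (u \<bullet> x)) *\<^sub>R u) = (if u = v then sqrt (c v) * (v \<bullet> x) else 0)"
        using pairwiseD[OF E(2) that] vv[OF that] by (cases "u = v") (auto simp: orthogonal_def)
    qed simp
    then show ?thesis using E(1) that by simp
  qed
  have "R ** R = A"
  proof (subst matrix_eq, intro allI)
    fix x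
    have "(R ** R) *v x = (\<Sum>v\<in>E. (c v * (v \<bullet> x)) *\<^sub>R v)"
      unfolding matrix_vector_mul_assoc[symmetric] Rr
      by (subst (1) r_def) (use vr c_pos in \<open>auto intro!: sum.cong simp: less_imp_le mult.assoc[symmetric]\<close>)
    also have "\<dots> = (\<Sum>v\<in>E. A *v ((v \<bullet> x) *\<^sub>R v))"
      by (intro sum.cong) (auto simp: matrix_vector_mult_scaleR c)
    also have "\<dots> = A *v x" by (subst (2) ev[symmetric]) (simp add: linear_sum)
    finally show "(R ** R) *v x = A *v x" .
  qed
  moreover have "pos_def R"
    unfolding pos_def_def
  proof (intro conjI allI impI)
    have "r x \<bullet> y = x \<bullet> r y" for x y
      unfolding r_def inner_sum_left inner_sum_right
      by (intro sum.cong) (auto simp: inner_commute)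
    then have "(transpose R *v x) \<bullet> y = (R *v x) \<bullet> y" for x y
      by (metis Rr dot_lmul_matrix transpose_matrix_vector)
    then show "transpose R = R" by (metis matrix_eq vector_eq_rdot)
  next
    fix x :: "real^'n" assume "x \<noteq> 0"
    then obtain u where u: "u \<in> E" "u \<bullet> x \<noteq> 0" using ev[of x] by (metis (no_types, lifting) scaleR_zero_left sum.neutral)
    have "x \<bullet> (R *v x) = (\<Sum>v\<in>E. sqrt (c v) * (v \<bullet> x)\<^sup>2)"
      unfolding Rr r_def inner_sum_right
      by (intro sum.cong) (auto simp: inner_commute power2_eq_square)
    also have "\<dots> > 0" using u c_pos E(1) by (intro sum_pos2[of _ u]) (auto simp: less_imp_le)
    finally show "0 < x \<bullet> (R *v x)" .
  qed
  moreover have "S = R" if S: "pos_def S" "S ** S = A" for S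
  proof -
    have Sv: "S *v v = sqrt (c v) *\<^sub>R v" if v: "v \<in> E" for v
    proof -
      define w where "w = S *v v - sqrt (c v) *\<^sub>R v"
      have "S *v (S *v v) = c v *\<^sub>R v" using S(2) c[OF v] by (simp add: matrix_vector_mul_assoc)
      then have "S *v w = - sqrt (c v) *\<^sub>R w"
        using c_pos[OF v]
        by (simp add: w_def matrix_vector_mult_diff_distrib matrix_vector_mult_scaleR algebra_simps)
      then have "w \<bullet> (S *v w) = - sqrt (c v) * (w \<bullet> w)" by simp
      moreover have "sqrt (c v) * (w \<bullet> w) \<ge> 0" using c_pos[OF v] by (simp add: less_imp_le)
      ultimately have "w = 0" using S(1) by (fastforce simp: pos_def_def)
      then show ?thesis by (simp add: w_def)
    qed
    have "S *v x = R *v x" for x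
    proof -
      have "S *v x = (\<Sum>v\<in>E. S *v ((v \<bullet> x) *\<^sub>R v))"
        by (subst (1) ev[symmetric]) (simp add: linear_sum)
      also have "\<dots> = R *v x" unfolding Rr r_def
        by (intro sum.cong) (auto simp: matrix_vector_mult_scaleR Sv)
      finally show ?thesis .
    qed
    then show ?thesis by (simp add: matrix_eq)
  qed
  ultimately show ?thesis by blast
qed

lemma pos_def_matrix_inv:
  fixes A :: "real^'n^'n"
  assumes "pos_def A"
  shows "pos_def (matrix_inv A)"
proof -
  have "\<forall>x. A *v x = 0 \<longrightarrow> x = 0" using assms by (metis inner_zero_right less_irrefl pos_def_def)
  then have "invertible A" by (simp add: invertible_left_inverse matrix_left_invertible_ker)
  then have inv: "A ** matrix_inv A = mat 1" "matrix_inv A ** A = mat 1"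
    unfolding matrix_inv_def invertible_def by (rule someI2_ex; simp)+
  have tr: "transpose A = A" using assms by (simp add: pos_def_def)
  have "transpose (matrix_inv A) ** A = mat 1"
    using inv(1) by (metis matrix_transpose_mul tr transpose_mat)
  then have "transpose (matrix_inv A) = matrix_inv A"
    by (metis inv(1) matrix_mul_assoc matrix_mul_lid matrix_mul_rid)
  moreover have "0 < x \<bullet> (matrix_inv A *v x)" if "x \<noteq> 0" for x
  proof -
    define y where "y = matrix_inv A *v x"
    have x: "x = A *v y" by (simp add: y_def matrix_vector_mul_assoc inv)
    then have "y \<noteq> 0" using that by auto
    then have "y \<bullet> (A *v y) > 0" using assms by (simp add: pos_def_def)
    then show ?thesis unfolding y_def[symmetric] x[symmetric] by (simp only: inner_commute)
  qed
  ultimately show ?thesis by (simp add: pos_def_def)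
qed

lemma pos_def_inv_sqrt:
  assumes "pos_def A"
  shows "pos_def (inv_sqrt A)"
  using theI'[OF pos_def_unique_square_root[OF pos_def_matrix_inv[OF assms]]]
  by (simp add: inv_sqrt_def)

lemma pos_def_congruence:
  fixes \<Sigma> :: "real^'m^'m" and K :: "real^'n^'m"
  assumes "pos_def \<Sigma>" and inj: "\<And>x. K *v x = 0 \<Longrightarrow> x = 0"
  shows "pos_def (transpose K ** \<Sigma> ** K)"
proof -
  have "transpose (transpose K ** \<Sigma> ** K) = transpose K ** \<Sigma> ** K"
    using assms(1) by (simp add: matrix_transpose_mul matrix_mul_assoc pos_def_def)
  moreover have "x \<bullet> ((transpose K ** \<Sigma> ** K) *v x) = (K *v x) \<bullet> (\<Sigma> *v (K *v x))" for x
    by (simp add: matrix_vector_mul_assoc[symmetric] transpose_matrix_vector)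
       (metis dot_lmul_matrix inner_commute)
  ultimately show ?thesis using assms by (auto simp: pos_def_def)
qed

lemma kron_I_mult_component: "(kron_I v *v x) $ p = v $ fst p * x $ snd p"
proof -
  have "(kron_I v *v x) $ p = (\<Sum>j\<in>UNIV. if snd p = j then v $ fst p * x $ j else 0)"
    unfolding matrix_vector_mult_def kron_I_def vec_lambda_beta by (rule sum.cong) (auto simp: mat_def)
  then show ?thesis by simp
qed

text \<open>The mean of \<open>s\<close> therefore separates the alternative from the null as soon as \<open>\<mu> \<noteq> 0\<close>.\<close>

lemma C_mat_injective:
  assumes "pos_def \<Sigma>" "C_mat \<Sigma> \<beta>0 *v \<mu> = 0"
  shows "\<mu> = 0"
proof -
  have "x = 0" if "kron_I (b_vec \<beta>0) *v x = 0" for x :: "real^'a"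
  proof -
    have "x $ i = 0" for i
      using arg_cong[OF that, of "\<lambda>y. y $ (1, i)"]
      by (simp add: kron_I_mult_component b_vec_def vector_2)
    then show ?thesis by (simp add: vec_eq_iff)
  qed
  then have "pos_def (C_mat \<Sigma> \<beta>0)"
    unfolding C_mat_def by (intro pos_def_inv_sqrt pos_def_congruence assms(1))
  then show ?thesis using assms(2) by (fastforce simp: pos_def_def)
qed

section \<open>Almost everywhere limits in midpoint-convex families\<close>

text \<open>A substitute for weak* compactness. Elements of nearly minimal \<open>L\<^sup>2\<close> norm in \<open>K n\<close> are close to each other:
  the norm of their midpoint, which also lies in \<open>K n\<close>, cannot be much smaller, so by the parallelogram
  identity their difference has small norm. Choosing them fast enough makes the increments summable
  almost everywhere.\<close>

lemma midpoint_convex_AE_compactness: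
  fixes K :: "nat \<Rightarrow> ('a \<Rightarrow> real) set"
  assumes M: "finite_measure M"
    and ne: "\<And>n. K n \<noteq> {}" and dec: "\<And>n. K (Suc n) \<subseteq> K n"
    and meas: "\<And>n u. u \<in> K n \<Longrightarrow> u \<in> borel_measurable M"
    and bnd: "\<And>n u x. u \<in> K n \<Longrightarrow> 0 \<le> u x \<and> u x \<le> 1"
    and mid: "\<And>n u v. u \<in> K n \<Longrightarrow> v \<in> K n \<Longrightarrow> (\<lambda>x. (u x + v x) / 2) \<in> K n"
  shows "\<exists>\<psi> u. (\<forall>n. \<psi> n \<in> K n) \<and> u \<in> borel_measurable M \<and> (\<forall>x. 0 \<le> u x \<and> u x \<le> 1) \<and>
    (AE x in M. (\<lambda>n. \<psi> n x) \<longlonglongrightarrow> u x)"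
proof -
  interpret finite_measure M by fact
  have anti: "K j \<subseteq> K i" if "i \<le> j" for i j
    using decseq_SucI[of K, OF dec] that by (auto simp: decseq_def)
  define N where "N u = (\<integral>x. (u x)\<^sup>2 \<partial>M)" for u :: "'a \<Rightarrow> real"
  have int_prod: "integrable M (\<lambda>x. u x * v x)" if "u \<in> K i" "v \<in> K j" for u v i j
  proof (rule integrable_const_bound[of _ 1])
    have "\<bar>u x * v x\<bar> \<le> 1" for x
      using bnd[OF that(1), of x] bnd[OF that(2), of x] by (simp add: abs_mult mult_le_one)
    then show "AE x in M. norm (u x * v x) \<le> 1" by simp
  qed (use meas that in measurable)
  have int_sq: "integrable M (\<lambda>x. (u x)\<^sup>2)" if "u \<in> K i" for u i
    using int_prod[OF that that] by (simp add: power2_eq_square)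
  have N_nonneg: "0 \<le> N u" for u by (simp add: N_def)
  have N_le: "N u \<le> measure M (space M)" if "u \<in> K i" for u i
  proof -
    have "N u \<le> (\<integral>x. 1 \<partial>M)" unfolding N_def
      using bnd[OF that] by (intro integral_mono int_sq[OF that]) (auto simp: power_le_one)
    then show ?thesis by simp
  qed
  define a where "a n = Inf (N ` K n)" for n
  have bdd: "bdd_below (N ` K n)" for n using N_nonneg by (intro bdd_belowI[of _ 0]) auto
  have a_le: "a n \<le> N u" if "u \<in> K n" for n u unfolding a_def by (intro cInf_lower bdd imageI that)
  have "incseq a" unfolding a_def using ne anti bdd
    by (intro monoI cInf_superset_mono image_mono) auto
  have bdd_a: "bdd_above (range a)"
  proof (rule bdd_aboveI)
    fix y assume "y \<in> range a"
    then obtain n where n: "y = a n" by blast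
    obtain u where "u \<in> K n" using ne[of n] by blast
    then show "y \<le> measure M (space M)" using a_le N_le n by force
  qed
  define s where "s = (SUP n. a n)"
  have a_s: "a n \<le> s" for n unfolding s_def by (intro cSUP_upper bdd_a) simp
  \<comment> \<open>The factor 8 is what the parallelogram identity loses below.\<close>
  define \<epsilon> where "\<epsilon> j = (1/4 :: real)^j / 8" for j :: nat
  have eps: "\<epsilon> j > 0" "\<epsilon> (Suc j) \<le> \<epsilon> j" for j by (auto simp: \<epsilon>_def)
  have "\<exists>n\<ge>j. s - \<epsilon> j \<le> a n" for j
  proof -
    obtain n where n: "s - \<epsilon> j < a n"
      using less_cSUP_iff[OF _ bdd_a, of "s - \<epsilon> j"] eps(1)[of j] by (auto simp: s_def)
    have "a n \<le> a (max j n)" using \<open>incseq a\<close> by (simp add: incseq_def)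
    then show ?thesis using n by (intro exI[of _ "max j n"]) auto
  qed
  then obtain n where n: "\<And>j. n j \<ge> j" "\<And>j. s - \<epsilon> j \<le> a (n j)" by metis
  have "\<exists>u\<in>K (n j). N u < a (n j) + \<epsilon> j" for j
    using cInf_lessD[of "N ` K (n j)" "a (n j) + \<epsilon> j"] ne[of "n j"] eps(1)[of j] by (auto simp: a_def)
  then obtain \<psi> where \<psi>: "\<And>j. \<psi> j \<in> K (n j)" and N\<psi>: "\<And>j. N (\<psi> j) < a (n j) + \<epsilon> j" by metis
  have \<psi>K: "\<psi> j \<in> K j" for j using \<psi> anti n by blast
  define d where "d j x = \<psi> (Suc j) x - \<psi> j x" for j x
  have d_meas [measurable]: "d j \<in> borel_measurable M" for j
    unfolding d_def using \<psi>[THEN meas] by measurable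
  have int_d: "integrable M (d j)" "integrable M (\<lambda>x. (d j x)\<^sup>2)" for j
  proof -
    have b: "\<bar>d j x\<bar> \<le> 1" for x
      using bnd[OF \<psi>, of "Suc j" x] bnd[OF \<psi>, of j x] by (simp add: d_def abs_le_iff)
    show "integrable M (d j)" by (rule integrable_const_bound[of _ 1]) (use b in auto)
    show "integrable M (\<lambda>x. (d j x)\<^sup>2)"
      by (rule integrable_const_bound[of _ 1]) (use b in \<open>auto simp: abs_square_le_1\<close>)
  qed
  have Nd: "N (d j) \<le> (1/4)^j" for j
  proof -
    \<comment> \<open>Both elements and their midpoint lie in the larger of the two sets.\<close>
    let ?n = "min (n j) (n (Suc j))"
    have in': "\<psi> j \<in> K ?n" "\<psi> (Suc j) \<in> K ?n"
      using \<psi>[of j] \<psi>[of "Suc j"] anti[of ?n "n j"] anti[of ?n "n (Suc j)"] by auto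
    let ?m = "\<lambda>x. (\<psi> j x + \<psi> (Suc j) x) / 2"
    have m: "?m \<in> K ?n" using mid in' by blast
    have "s - \<epsilon> j \<le> a ?n" using n(2)[of j] n(2)[of "Suc j"] eps(2)[of j] by (auto simp: min_def)
    then have lo: "s - \<epsilon> j \<le> N ?m" using a_le[OF m] by linarith
    have up: "N (\<psi> j) \<le> s + \<epsilon> j" "N (\<psi> (Suc j)) \<le> s + \<epsilon> j"
      using N\<psi>[of j] N\<psi>[of "Suc j"] a_s[of "n j"] a_s[of "n (Suc j)"] eps(2)[of j] by linarith+
    have "N (d j) = (\<integral>x. 2 * (\<psi> j x)\<^sup>2 + 2 * (\<psi> (Suc j) x)\<^sup>2 - 4 * (?m x)\<^sup>2 \<partial>M)"
      unfolding N_def d_def by (intro Bochner_Integration.integral_cong) (auto simp: power2_eq_square field_simps)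
    also have "\<dots> = 2 * N (\<psi> j) + 2 * N (\<psi> (Suc j)) - 4 * N ?m"
      unfolding N_def using int_sq[OF \<psi>, of j] int_sq[OF \<psi>, of "Suc j"] int_sq[OF m]
      by (subst Bochner_Integration.integral_diff Bochner_Integration.integral_add; simp)+
    also have "\<dots> \<le> 8 * \<epsilon> j" using lo up by linarith
    finally show ?thesis by (simp add: \<epsilon>_def)
  qed
  have L1: "(\<integral>x. \<bar>d j x\<bar> \<partial>M) \<le> (1/2)^j * (measure M (space M) + 1)" for j
  proof -
    \<comment> \<open>An elementary replacement for the Cauchy-Schwarz inequality, balanced for squared norms of order 4^(-j).\<close>
    have amgm: "\<bar>d j x\<bar> \<le> (1/2)^j + 2^j * (d j x)\<^sup>2" for x
    proof -
      have "0 \<le> (1 - 2^j * \<bar>d j x\<bar>)\<^sup>2" by simp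
      then have "2 * (2^j * \<bar>d j x\<bar>) \<le> 1 + 2^j * (2^j * (d j x)\<^sup>2)"
        by (simp add: power2_eq_square algebra_simps)
      moreover have "0 \<le> 2^j * \<bar>d j x\<bar>" by simp
      ultimately have "2^j * \<bar>d j x\<bar> \<le> 1 + 2^j * (2^j * (d j x)\<^sup>2)" by linarith
      then show ?thesis by (simp add: power_divide field_simps)
    qed
    have "(\<integral>x. \<bar>d j x\<bar> \<partial>M) \<le> (\<integral>x. (1/2)^j + 2^j * (d j x)\<^sup>2 \<partial>M)"
      using int_d[of j] amgm by (intro integral_mono) auto
    also have "\<dots> = (1/2)^j * measure M (space M) + 2^j * N (d j)"
      using int_d[of j] by (simp add: N_def)
    also have "\<dots> \<le> (1/2)^j * measure M (space M) + 2^j * (1/4)^j"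
      using Nd[of j] by simp
    also have "(2::real)^j * (1/4)^j = (1/2)^j" by (simp add: power_mult_distrib[symmetric])
    finally show ?thesis by (simp add: algebra_simps)
  qed
  have "(\<integral>\<^sup>+x. (\<Sum>j. ennreal \<bar>d j x\<bar>) \<partial>M) = (\<Sum>j. ennreal (\<integral>x. \<bar>d j x\<bar> \<partial>M))"
    using int_d by (subst nn_integral_suminf) (auto intro!: suminf_cong nn_integral_eq_integral)
  also have "\<dots> \<le> (\<Sum>j. ennreal ((1/2)^j * (measure M (space M) + 1)))"
    by (intro suminf_le ennreal_leI L1) auto
  also have "\<dots> = ennreal (\<Sum>j. (1/2)^j * (measure M (space M) + 1))"
    by (intro suminf_ennreal2 summable_mult2 summable_geometric) auto
  also have "\<dots> < \<infinity>" by simp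
  finally have "AE x in M. (\<Sum>j. ennreal \<bar>d j x\<bar>) \<noteq> \<infinity>"
    by (intro nn_integral_PInf_AE) auto
  then have conv: "AE x in M. convergent (\<lambda>j. \<psi> j x)"
  proof eventually_elim
    case (elim x)
    then have "summable (\<lambda>j. \<bar>d j x\<bar>)" by (intro summable_suminf_not_top) auto
    then have "summable (\<lambda>j. d j x)" by (rule summable_rabs_cancel)
    then have "convergent (\<lambda>k. \<Sum>j<k. d j x)" by (simp add: summable_iff_convergent)
    then have "convergent (\<lambda>k. \<psi> k x - \<psi> 0 x)"
      using sum_lessThan_telescope[of "\<lambda>j. \<psi> j x"] by (simp add: d_def)
    then show ?case by (simp add: convergent_diff_const_right_iff)
  qed
  define u where "u x = max 0 (min 1 (lim (\<lambda>j. \<psi> j x)))" for x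
  have "u \<in> borel_measurable M"
    unfolding u_def using \<psi>[THEN meas] by measurable
  moreover have "AE x in M. (\<lambda>j. \<psi> j x) \<longlonglongrightarrow> u x"
    using conv
  proof eventually_elim
    case (elim x)
    then have l: "(\<lambda>j. \<psi> j x) \<longlonglongrightarrow> lim (\<lambda>j. \<psi> j x)" by (simp add: convergent_LIMSEQ_iff)
    then have "0 \<le> lim (\<lambda>j. \<psi> j x)" "lim (\<lambda>j. \<psi> j x) \<le> 1"
      using bnd[OF \<psi>] by (auto intro: LIMSEQ_le_const LIMSEQ_le_const2)
    then show ?case using l by (simp add: u_def)
  qed
  ultimately show ?thesis using \<psi>K by (intro exI[of _ \<psi>] exI[of _ u]) (auto simp: u_def)
qed

section \<open>The Gaussian location family\<close>

definition gauss :: "'a::euclidean_space \<Rightarrow> 'a \<Rightarrow> real" where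
  "gauss m x = exp (- (norm (x - m))\<^sup>2 / 2) / sqrt (2 * pi) ^ DIM('a)"

lemma gauss_pos: "0 < gauss m x"
  by (simp add: gauss_def)

text \<open>All the densities are exponential tilts of the centred one. Convexity of the exponential function in this
  formula is what makes the optimal test unique.\<close>

lemma gauss_tilt: "gauss m x = exp (m \<bullet> x - (norm m)\<^sup>2 / 2) * gauss 0 x"
proof -
  have "- (norm (x - m))\<^sup>2 / 2 = (m \<bullet> x - (norm m)\<^sup>2 / 2) + (- (norm x)\<^sup>2 / 2)"
    by (simp add: power2_norm_eq_inner inner_diff_left inner_diff_right inner_commute field_simps)
  then show ?thesis by (simp only: gauss_def exp_add diff_zero times_divide_eq_right)
qed

lemma continuous_on_gauss [continuous_intros]:
  "continuous_on S f \<Longrightarrow> continuous_on S g \<Longrightarrow> continuous_on S (\<lambda>x. gauss (f x) (g x))"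
  unfolding gauss_def by (intro continuous_intros) auto

lemma measurable_gauss [measurable]:
  assumes [measurable]: "f \<in> borel_measurable M" "g \<in> borel_measurable M"
  shows "(\<lambda>x. gauss (f x) (g x)) \<in> borel_measurable M"
  unfolding gauss_def by measurable

lemma gauss_eq_prod_normal_density:
  "gauss m x = (\<Prod>b\<in>Basis. normal_density (m \<bullet> b) 1 (x \<bullet> b))"
proof -
  have "(norm (x - m))\<^sup>2 = (\<Sum>b\<in>Basis. ((x \<bullet> b) - (m \<bullet> b))\<^sup>2)"
    by (subst power2_norm_eq_inner, subst euclidean_inner)
       (simp add: inner_diff_left power2_eq_square)
  then show ?thesis
    by (simp add: gauss_def normal_density_def prod_dividef exp_sum[symmetric] sum_negf sum_divide_distrib)
qed

lemma has_bochner_integral_gauss: "has_bochner_integral lborel (gauss m) 1"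
proof (rule has_bochner_integral_nn_integral)
  have "(\<integral>\<^sup>+x. ennreal (gauss m x) \<partial>lborel)
      = (\<integral>\<^sup>+x. (\<Prod>b\<in>Basis. ennreal (normal_density (m \<bullet> b) 1 (x \<bullet> b))) \<partial>lborel)"
    by (simp add: gauss_eq_prod_normal_density prod_ennreal)
  also have "\<dots> = (\<Prod>b\<in>(Basis::'a set). \<integral>\<^sup>+x. normal_density (m \<bullet> b) 1 x \<partial>lborel)"
    by (rule nn_integral_lborel_prod) auto
  also have "\<dots> = 1"
    by (intro prod.neutral ballI) (simp add: nn_integral_eq_integral integral_normal_density)
  finally show "(\<integral>\<^sup>+x. ennreal (gauss m x) \<partial>lborel) = ennreal 1" by simp
qed (auto simp: gauss_pos less_imp_le)

lemma gauss_Pair: "gauss (m, n) (s, t) = gauss m s * gauss n t"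
  by (simp add: gauss_def norm_Pair power_add add_divide_distrib exp_add[symmetric])

lemma std_normal_vec_density_eq_gauss: "std_normal_vec_density m x = gauss m x"
proof -
  have "(norm (x - m))\<^sup>2 = (\<Sum>i\<in>UNIV. (x $ i - m $ i)\<^sup>2)"
    unfolding power2_norm_eq_inner by (simp add: inner_vec_def power2_eq_square)
  then show ?thesis
    by (simp add: std_normal_vec_density_def gauss_def normal_density_def prod_dividef
        exp_sum[symmetric] sum_negf sum_divide_distrib)
qed

section \<open>Power as a functional of test and mean\<close>

text \<open>The rejection probability of \<open>\<phi>\<close> when the mean is \<open>m\<close>, as a linear functional of an arbitrary bounded
  function; perturbations of tests are signed.\<close>

definition gauss_power :: "('a::euclidean_space \<Rightarrow> real) \<Rightarrow> 'a \<Rightarrow> real" where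
  "gauss_power \<phi> m = (LINT x|lborel. \<phi> x * gauss m x)"

lemma integrable_gauss [simp]: "integrable lborel (gauss m)"
  and integral_gauss [simp]: "(LINT x|lborel. gauss m x) = 1"
  using has_bochner_integral_gauss[of m] by (auto simp: has_bochner_integral_iff)

lemma abs_times_gauss_le: "\<bar>a\<bar> \<le> c \<Longrightarrow> \<bar>a * gauss m x\<bar> \<le> c * gauss m x"
  using gauss_pos[of m x] by (simp add: abs_mult abs_of_pos mult_right_mono)

lemma integrable_times_gauss:
  assumes [measurable]: "\<phi> \<in> borel_measurable borel" and "\<And>x. \<bar>\<phi> x\<bar> \<le> c"
  shows "integrable lborel (\<lambda>x. \<phi> x * gauss m x)"
proof (rule Bochner_Integration.integrable_bound[of _ "\<lambda>x. c * gauss m x"])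
  show "AE x in lborel. norm (\<phi> x * gauss m x) \<le> norm (c * gauss m x)"
  unfolding real_norm_def by (intro AE_I2 order_trans[OF abs_times_gauss_le[OF assms(2)] abs_ge_self])
qed auto

lemma gauss_power_abs_le:
  assumes [measurable]: "\<phi> \<in> borel_measurable borel" and b: "\<And>x. \<bar>\<phi> x\<bar> \<le> c"
  shows "\<bar>gauss_power \<phi> m\<bar> \<le> c"
proof -
  have "\<bar>gauss_power \<phi> m\<bar> \<le> (LINT x|lborel. \<bar>\<phi> x * gauss m x\<bar>)"
    unfolding gauss_power_def by (rule integral_abs_bound)
  also have "\<dots> \<le> (LINT x|lborel. c * gauss m x)"
    using integrable_times_gauss[OF assms, of m] abs_times_gauss_le[OF b]
    by (intro integral_mono integrable_abs integrable_mult_right integrable_gauss)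
  finally show ?thesis by simp
qed

text \<open>The densities converge pointwise and all have integral one, so they converge in \<open>L\<^sup>1\<close> by Scheffe's lemma,
  whatever the bounded function \<open>\<phi>\<close> is.\<close>

lemma gauss_power_tendsto_mean:
  assumes [measurable]: "\<phi> \<in> borel_measurable borel" and b: "\<And>x. \<bar>\<phi> x\<bar> \<le> c"
    and lim: "f \<longlonglongrightarrow> m"
  shows "(\<lambda>n::nat. gauss_power \<phi> (f n)) \<longlonglongrightarrow> gauss_power \<phi> m"
proof -
  have nn: "(\<integral>\<^sup>+x. norm (gauss k x) \<partial>lborel) = 1" for k :: 'a
  proof -
    have "(\<integral>\<^sup>+x. norm (gauss k x) \<partial>lborel) = (\<integral>\<^sup>+x. ennreal (gauss k x) \<partial>lborel)"
      by (simp add: abs_of_pos gauss_pos)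
    also have "\<dots> = ennreal 1"
      by (subst nn_integral_eq_integral) (auto simp: gauss_pos less_imp_le)
    finally show ?thesis by simp
  qed
  have "(\<lambda>n. \<integral>\<^sup>+x. norm (gauss (f n) x - gauss m x) \<partial>lborel) \<longlonglongrightarrow> 0"
  proof (rule Scheffe_lemma2)
    have "isCont (\<lambda>k. gauss k x) m" for x
      using continuous_on_gauss[OF continuous_on_id continuous_on_const, of UNIV x]
      by (simp add: continuous_on_eq_continuous_at)
    then show "AE x in lborel. (\<lambda>n. gauss (f n) x) \<longlonglongrightarrow> gauss m x"
      by (intro AE_I2 isCont_tendsto_compose[OF _ lim])
      show "(\<integral>\<^sup>+x. norm (gauss (f n) x) \<partial>lborel) \<le> (\<integral>\<^sup>+x. norm (gauss m x) \<partial>lborel)" for n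
      unfolding nn by simp
  qed auto
  then have lim0: "(\<lambda>n. ennreal c * (\<integral>\<^sup>+x. norm (gauss (f n) x - gauss m x) \<partial>lborel)) \<longlonglongrightarrow> ennreal c * 0"
    by (intro ennreal_tendsto_cmult) auto
  have c0: "c \<ge> 0" using b[of 0] by linarith
  show ?thesis
    unfolding gauss_power_def
  proof (rule tendsto_L1_int)
    show "(\<lambda>n. \<integral>\<^sup>+x. norm (\<phi> x * gauss (f n) x - \<phi> x * gauss m x) \<partial>lborel) \<longlonglongrightarrow> 0"
    proof (rule tendsto_sandwich[OF _ _ tendsto_const])
      show "\<forall>\<^sub>F n in sequentially. (\<integral>\<^sup>+x. norm (\<phi> x * gauss (f n) x - \<phi> x * gauss m x) \<partial>lborel)
          \<le> ennreal c * (\<integral>\<^sup>+x. norm (gauss (f n) x - gauss m x) \<partial>lborel)"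
        using b c0
        by (intro always_eventually allI)
           (auto simp: nn_integral_cmult[symmetric] ennreal_mult[symmetric] abs_mult right_diff_distrib[symmetric]
             intro!: nn_integral_mono ennreal_leI mult_right_mono)
    qed (use lim0 in auto)
  qed (use integrable_times_gauss[OF assms(1) b] in auto)
qed

lemma gauss_power_continuous:
  fixes m :: "'p::metric_space \<Rightarrow> 'a::euclidean_space"
  assumes "\<phi> \<in> borel_measurable borel" "\<And>x. \<bar>\<phi> x\<bar> \<le> c" "continuous_on S m"
  shows "continuous_on S (\<lambda>\<theta>. gauss_power \<phi> (m \<theta>))"
  unfolding continuous_on_sequentially comp_def
proof (intro allI ballI impI)
  fix x a assume "a \<in> S" and x: "(\<forall>n. x n \<in> S) \<and> x \<longlonglongrightarrow> a"
  then have "(\<lambda>n. m (x n)) \<longlonglongrightarrow> m a"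
    using assms(3) unfolding continuous_on_sequentially comp_def by blast
  then show "(\<lambda>n. gauss_power \<phi> (m (x n))) \<longlonglongrightarrow> gauss_power \<phi> (m a)"
    by (rule gauss_power_tendsto_mean[OF assms(1,2)])
qed

lemma gauss_power_cong_AE:
  assumes [measurable]: "\<phi> \<in> borel_measurable borel" "\<psi> \<in> borel_measurable borel"
    and "AE x in lborel. \<phi> x = \<psi> x"
  shows "gauss_power \<phi> m = gauss_power \<psi> m"
  unfolding gauss_power_def by (rule integral_cong_AE) (use assms(3) in auto)

lemma gauss_power_add:
  assumes "\<phi> \<in> borel_measurable borel" "\<And>x. \<bar>\<phi> x\<bar> \<le> c" "\<psi> \<in> borel_measurable borel" "\<And>x. \<bar>\<psi> x\<bar> \<le> d"
  shows "gauss_power (\<lambda>x. a * \<phi> x + b * \<psi> x) m = a * gauss_power \<phi> m + b * gauss_power \<psi> m"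
  using integrable_times_gauss[OF assms(1,2)] integrable_times_gauss[OF assms(3,4)]
  by (simp add: gauss_power_def distrib_right mult.assoc)

lemma gauss_power_const: "gauss_power (\<lambda>_. c) m = c"
  by (simp add: gauss_power_def)

text \<open>Fubini's theorem: a mixture of densities tests \<open>\<phi>\<close> against the same mixture of its powers. This
  translates between mixture densities, in which Bayes tests are defined, and integrals over the parameter,
  in which constraints and penalties are expressed.\<close>

lemma gauss_power_mixture:
  fixes L :: "'p::euclidean_space measure" and m :: "'p \<Rightarrow> 'a::euclidean_space"
  assumes L: "finite_measure L" and sL [measurable_cong]: "sets L = sets borel"
    and m: "continuous_on UNIV m"
    and \<phi> [measurable]: "\<phi> \<in> borel_measurable borel" and b: "\<And>x. \<bar>\<phi> x\<bar> \<le> c"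
    and w [measurable]: "w \<in> borel_measurable borel" and d: "\<And>\<theta>. \<bar>w \<theta>\<bar> \<le> d"
  shows "integrable lborel (\<lambda>x. \<phi> x * (LINT \<theta>|L. w \<theta> * gauss (m \<theta>) x))" (is ?int)
    and "(LINT x|lborel. \<phi> x * (LINT \<theta>|L. w \<theta> * gauss (m \<theta>) x)) = (LINT \<theta>|L. w \<theta> * gauss_power \<phi> (m \<theta>))"
      (is ?eq)
proof -
  interpret L: finite_measure L by fact
  interpret pair_sigma_finite L "lborel :: 'a measure" ..
  have m' [measurable]: "m \<in> borel_measurable borel" using m by (rule borel_measurable_continuous_onI)
  let ?f = "\<lambda>\<theta> x. \<phi> x * (w \<theta> * gauss (m \<theta>) x)"
  have row: "integrable lborel (?f \<theta>)" for \<theta>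
    using integrable_times_gauss[OF \<phi> b, of "m \<theta>", THEN integrable_mult_right, of "w \<theta>"]
    by (simp add: mult_ac)
  have bnd: "norm (LINT x|lborel. norm (?f \<theta> x)) \<le> c * d" for \<theta>
  proof -
    have "(LINT x|lborel. norm (?f \<theta> x)) \<le> (LINT x|lborel. c * d * gauss (m \<theta>) x)"
    proof (intro integral_mono integrable_norm row integrable_mult_right integrable_gauss)
      fix x
      have "\<bar>\<phi> x * w \<theta>\<bar> \<le> c * d"
        unfolding abs_mult using b d by (intro mult_mono order_trans[OF abs_ge_zero b]) auto
      then show "norm (?f \<theta> x) \<le> c * d * gauss (m \<theta>) x"
        using abs_times_gauss_le by (simp add: mult.assoc[symmetric])
    qed
    then show ?thesis by simp
  qed
  have main: "integrable L (\<lambda>\<theta>. LINT x|lborel. norm (?f \<theta> x))"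
  proof (rule L.integrable_const_bound[of _ "c * d"])
    show "AE \<theta> in L. norm (LINT x|lborel. norm (?f \<theta> x)) \<le> c * d" using bnd by blast
    show "(\<lambda>\<theta>. LINT x|lborel. norm (?f \<theta> x)) \<in> borel_measurable L" by measurable
  qed
  have int: "integrable (L \<Otimes>\<^sub>M lborel) (case_prod ?f)"
  proof (rule Fubini_integrable)
    show "case_prod ?f \<in> borel_measurable (L \<Otimes>\<^sub>M lborel)" by measurable
    show "integrable L (\<lambda>\<theta>. LINT x|lborel. norm (case_prod ?f (\<theta>, x)))"
      using main by (simp only: case_prod_conv)
    show "AE \<theta> in L. integrable lborel (\<lambda>x. case_prod ?f (\<theta>, x))"
      using row by (simp only: case_prod_conv) simp
  qed
  show ?int using integrable_snd[OF int] by simp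
  have "(LINT x|lborel. ?f \<theta> x) = w \<theta> * gauss_power \<phi> (m \<theta>)" for \<theta>
    unfolding gauss_power_def by (subst mult.left_commute) simp
  then show ?eq using Fubini_integral[OF int] by simp
qed

text \<open>This is how full support of the weight is used: a continuous function that is nonnegative on \<open>A\<close>
  and positive at one point of \<open>A\<close> is positive on an open set that the weight charges.\<close>

lemma full_support_integral_zero:
  fixes u :: "'p::euclidean_space \<Rightarrow> real"
  assumes L: "finite_measure L" and sL: "sets L = sets borel"
    and A: "AE \<theta> in L. \<theta> \<in> A" and supp: "full_support_on A L"
    and cont: "continuous_on UNIV u" and bnd: "\<And>\<theta>. \<bar>u \<theta>\<bar> \<le> c"
    and nonneg: "\<And>\<theta>. \<theta> \<in> A \<Longrightarrow> 0 \<le> u \<theta>" and le: "(LINT \<theta>|L. u \<theta>) \<le> 0"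
    and \<theta>: "\<theta> \<in> A"
  shows "u \<theta> = 0"
proof (rule ccontr)
  assume "u \<theta> \<noteq> 0"
  interpret L: finite_measure L by fact
  have um: "u \<in> borel_measurable L"
    using borel_measurable_continuous_onI[OF cont] sL by (simp cong: measurable_cong_sets)
  have nn: "AE \<theta> in L. 0 \<le> u \<theta>" using A nonneg by auto
  have int: "integrable L u" by (rule L.integrable_const_bound[of _ c]) (use um bnd in auto)
  have "(LINT \<theta>|L. u \<theta>) = 0" using le integral_nonneg_AE[OF nn] by linarith
  then have ae: "AE \<theta> in L. u \<theta> = 0" using integral_nonneg_eq_0_iff_AE[OF int nn] by simp
  let ?U = "{\<theta>. 0 < u \<theta>}"
  have "open ?U" using cont by (intro open_Collect_less continuous_intros)
  moreover have "\<theta> \<in> ?U \<inter> A" using \<theta> nonneg[OF \<theta>] \<open>u \<theta> \<noteq> 0\<close> by auto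
  ultimately have "emeasure L ?U > 0" using supp unfolding full_support_on_def by blast
  moreover have "AE \<theta> in L. \<not> 0 < u \<theta>" using ae by eventually_elim simp
  then have "emeasure L ?U = 0"
    using emeasure_eq_0_AE[of "\<lambda>\<theta>. 0 < u \<theta>" L] sets_eq_imp_space_eq[OF sL] by simp
  ultimately show False by simp
qed

section \<open>Limits of tests\<close>

text \<open>Lebesgue measure is infinite, but the standard Gaussian measure is finite and has the same null sets.\<close>

lemma tests_AE_compact:
  fixes K :: "nat \<Rightarrow> ((real^'k) \<times> (real^'k) \<Rightarrow> real) set"
  assumes "\<And>n. K n \<noteq> {}" "\<And>n. K (Suc n) \<subseteq> K n" and test: "\<And>n u. u \<in> K n \<Longrightarrow> is_test u"
    and "\<And>n u v. u \<in> K n \<Longrightarrow> v \<in> K n \<Longrightarrow> (\<lambda>x. (u x + v x) / 2) \<in> K n"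
  shows "\<exists>\<psi> u. (\<forall>n. \<psi> n \<in> K n) \<and> is_test u \<and> (AE x in lborel. (\<lambda>n. \<psi> n x) \<longlonglongrightarrow> u x)"
proof -
  let ?M = "density lborel (\<lambda>x. ennreal (gauss 0 x))"
  have "finite_measure ?M"
    by (rule finite_measureI) (simp add: emeasure_density nn_integral_eq_integral gauss_pos less_imp_le)
  then have "\<exists>\<psi> u. (\<forall>n. \<psi> n \<in> K n) \<and> u \<in> borel_measurable ?M \<and> (\<forall>x. 0 \<le> u x \<and> u x \<le> 1) \<and>
    (AE x in ?M. (\<lambda>n. \<psi> n x) \<longlonglongrightarrow> u x)"
    using assms(1,2,4) test
    by (intro midpoint_convex_AE_compactness) (auto simp: is_test_def)
  then show ?thesis
    by (auto simp: AE_density gauss_pos is_test_def)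
qed

lemma is_test_midpoint: "is_test u \<Longrightarrow> is_test v \<Longrightarrow> is_test (\<lambda>x. (u x + v x) / 2)"
  unfolding is_test_def
proof (intro conjI allI)
  fix x
  assume "u \<in> borel_measurable borel \<and> (\<forall>x. 0 \<le> u x \<and> u x \<le> 1)"
    and "v \<in> borel_measurable borel \<and> (\<forall>x. 0 \<le> v x \<and> v x \<le> 1)"
  then have "0 \<le> u x" "u x \<le> 1" "0 \<le> v x" "v x \<le> 1" by blast+
  then show "0 \<le> (u x + v x) / 2" "(u x + v x) / 2 \<le> 1" by simp_all
qed (auto intro!: borel_measurable_add borel_measurable_divide)

lemma is_testD:
  assumes "is_test \<phi>"
  shows "\<phi> \<in> borel_measurable borel" "\<bar>\<phi> x\<bar> \<le> 1" "0 \<le> \<phi> x" "\<phi> x \<le> 1"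
  using assms[unfolded is_test_def, THEN conjunct2, rule_format, of x] assms
  by (simp_all add: is_test_def)

lemma abs_test_times_le:
  assumes "is_test \<phi>"
  shows "\<bar>\<phi> x * y\<bar> \<le> \<bar>y\<bar>"
  unfolding abs_mult by (rule mult_left_le_one_le) (use is_testD(2)[OF assms, of x] in auto)

lemma gauss_power_test:
  assumes "is_test \<phi>"
  shows "0 \<le> gauss_power \<phi> m" "gauss_power \<phi> m \<le> 1" "\<bar>gauss_power \<phi> m\<bar> \<le> 1"
proof -
  show "0 \<le> gauss_power \<phi> m" unfolding gauss_power_def
    using is_testD(3)[OF assms] gauss_pos[THEN less_imp_le]
    by (intro integral_nonneg_AE AE_I2 mult_nonneg_nonneg) auto
  show "\<bar>gauss_power \<phi> m\<bar> \<le> 1" by (rule gauss_power_abs_le[OF is_testD(1,2)[OF assms]])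
  then show "gauss_power \<phi> m \<le> 1" by linarith
qed

lemma gauss_power_midpoint:
  assumes "is_test u" "is_test v"
  shows "gauss_power (\<lambda>x. (u x + v x) / 2) m = (gauss_power u m + gauss_power v m) / 2"
  using gauss_power_add[OF is_testD(1,2)[OF assms(1)] is_testD(1,2)[OF assms(2)], of "1/2" "1/2"]
  by (simp add: add_divide_distrib)

lemma gauss_power_tendsto_test:
  assumes "\<And>n. is_test (\<psi> n)" "is_test u" "AE x in lborel. (\<lambda>n. \<psi> n x) \<longlonglongrightarrow> u x"
  shows "(\<lambda>n. gauss_power (\<psi> n) m) \<longlonglongrightarrow> gauss_power u m"
  unfolding gauss_power_def
proof (rule integral_dominated_convergence[of _ _ _ "gauss m"])
  show "AE x in lborel. (\<lambda>n. \<psi> n x * gauss m x) \<longlonglongrightarrow> u x * gauss m x"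
    using assms(3) by eventually_elim (intro tendsto_intros)
  show "AE x in lborel. norm (\<psi> n x * gauss m x) \<le> gauss m x" for n
    using is_testD(2)[OF assms(1)] gauss_pos[of m]
    by (auto simp: abs_mult abs_of_pos intro!: mult_left_le_one_le less_imp_le)
qed (use assms is_testD(1) in \<open>auto intro!: borel_measurable_times simp: measurable_lborel1\<close>)

lemma test_integrable:
  assumes "is_test \<phi>" "integrable lborel g"
  shows "integrable lborel (\<lambda>x. \<phi> x * g x)"
proof (rule Bochner_Integration.integrable_bound[OF assms(2)])
  show "(\<lambda>x. \<phi> x * g x) \<in> borel_measurable lborel"
    using is_testD(1)[OF assms(1)] assms(2) by measurable
  show "AE x in lborel. norm (\<phi> x * g x) \<le> norm (g x)"
    unfolding real_norm_def by (intro AE_I2 abs_test_times_le assms)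
qed

lemma test_integral_tendsto:
  assumes \<psi>: "\<And>n. is_test (\<psi> n)" and u: "is_test u"
    and lim: "AE x in lborel. (\<lambda>n. \<psi> n x) \<longlonglongrightarrow> u x" and g: "integrable lborel g"
  shows "(\<lambda>n. LINT x|lborel. \<psi> n x * g x) \<longlonglongrightarrow> (LINT x|lborel. u x * g x)"
proof (rule integral_dominated_convergence[of _ _ _ "\<lambda>x. \<bar>g x\<bar>"])
  show "AE x in lborel. (\<lambda>n. \<psi> n x * g x) \<longlonglongrightarrow> u x * g x"
    using lim by eventually_elim (intro tendsto_intros)
  show "AE x in lborel. norm (\<psi> n x * g x) \<le> \<bar>g x\<bar>" for n
    unfolding real_norm_def by (intro AE_I2 abs_test_times_le \<psi>)
qed (use test_integrable[OF u g] test_integrable[OF \<psi> g] g in auto)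

text \<open>The superlevel sets of a midpoint-concave functional form a decreasing family to which
  \<open>tests_AE_compact\<close> applies.\<close>

lemma maximum_attained_on_tests:
  fixes T :: "((real^'k) \<times> (real^'k) \<Rightarrow> real) set" and F :: "_ \<Rightarrow> real"
  assumes ne: "T \<noteq> {}" and test: "\<And>u. u \<in> T \<Longrightarrow> is_test u"
    and mid: "\<And>u v. u \<in> T \<Longrightarrow> v \<in> T \<Longrightarrow> (\<lambda>x. (u x + v x) / 2) \<in> T"
    and closed: "\<And>\<psi> u. (\<And>n. \<psi> n \<in> T) \<Longrightarrow> is_test u \<Longrightarrow>
      (AE x in lborel. (\<lambda>n. \<psi> n x) \<longlonglongrightarrow> u x) \<Longrightarrow> u \<in> T"
    and concave: "\<And>u v. u \<in> T \<Longrightarrow> v \<in> T \<Longrightarrow> (F u + F v) / 2 \<le> F (\<lambda>x. (u x + v x) / 2)"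
    and cont: "\<And>\<psi> u. (\<And>n. is_test (\<psi> n)) \<Longrightarrow> is_test u \<Longrightarrow>
      (AE x in lborel. (\<lambda>n. \<psi> n x) \<longlonglongrightarrow> u x) \<Longrightarrow> (\<lambda>n. F (\<psi> n)) \<longlonglongrightarrow> F u"
    and bdd: "bdd_above (F ` T)"
  shows "\<exists>\<phi>\<in>T. \<forall>\<psi>\<in>T. F \<psi> \<le> F \<phi>"
proof -
  define s where "s = (SUP u\<in>T. F u)"
  define K where "K n = {u \<in> T. s - 1 / real (Suc n) \<le> F u}" for n
  have "\<exists>\<psi> u. (\<forall>n. \<psi> n \<in> K n) \<and> is_test u \<and> (AE x in lborel. (\<lambda>n. \<psi> n x) \<longlonglongrightarrow> u x)"
  proof (rule tests_AE_compact)
    fix n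
    show "K n \<noteq> {}"
      using less_cSUP_iff[OF ne bdd, of "s - 1 / real (Suc n)"]
      by (auto simp: K_def s_def[symmetric] intro: less_imp_le)
    show "K (Suc n) \<subseteq> K n"
    proof
      fix u assume "u \<in> K (Suc n)"
      moreover have "1 / real (Suc (Suc n)) \<le> 1 / real (Suc n)" by (simp add: frac_le)
      ultimately show "u \<in> K n" by (auto simp: K_def)
    qed
    show "is_test u" if "u \<in> K n" for u using that test by (simp add: K_def)
    show "(\<lambda>x. (u x + v x) / 2) \<in> K n" if "u \<in> K n" "v \<in> K n" for u v
      using that concave[of u v] mid[of u v] by (auto simp: K_def)
  qed
  then obtain \<psi> u where \<psi>: "\<And>n. \<psi> n \<in> K n" and u: "is_test u"
    and lim: "AE x in lborel. (\<lambda>n. \<psi> n x) \<longlonglongrightarrow> u x" by blast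
  have T: "\<psi> n \<in> T" for n using \<psi>[of n] by (simp add: K_def)
  have "(\<lambda>n. F (\<psi> n)) \<longlonglongrightarrow> F u" using cont test T u lim by blast
  moreover have "(\<lambda>n. s - 1 / real (Suc n)) \<longlonglongrightarrow> s - 0"
    by (intro tendsto_intros LIMSEQ_Suc[OF lim_1_over_n])
  ultimately have "s - 0 \<le> F u"
    using \<psi> by (intro LIMSEQ_le) (auto simp: K_def)
  moreover have "F v \<le> s" if "v \<in> T" for v unfolding s_def using that bdd by (rule cSUP_upper)
  ultimately show ?thesis using closed[OF T u lim] by (intro bexI[of _ u]) force+
qed

section \<open>Penalised average power\<close>

lemma positive_part_sq_midpoint:
  fixes a b :: real
  shows "(max 0 ((a + b) / 2))\<^sup>2 \<le> ((max 0 a)\<^sup>2 + (max 0 b)\<^sup>2) / 2"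
proof -
  have "(max 0 ((a + b) / 2))\<^sup>2 \<le> ((max 0 a + max 0 b) / 2)\<^sup>2" by (intro power_mono) (auto simp: max_def)
  also have "\<dots> \<le> ((max 0 a)\<^sup>2 + (max 0 b)\<^sup>2) / 2"
    using sum_squares_bound[of "max 0 a" "max 0 b"] by (simp add: power2_eq_square field_simps)
  finally show ?thesis .
qed

text \<open>A first order expansion of the squared positive part with a remainder that is uniform in \<open>x\<close>.\<close>

lemma positive_part_sq_add: "(max 0 (x + y))\<^sup>2 \<le> (max 0 x)\<^sup>2 + 2 * y * max 0 x + y\<^sup>2" for x y :: real
proof (cases "x \<ge> 0")
  case True
  have "(max 0 (x + y))\<^sup>2 \<le> (x + y)\<^sup>2" by (auto simp: max_def)
  then show ?thesis using True by (simp only: max.absorb2) (simp add: power2_sum algebra_simps)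
next
  case False
  then have "max 0 (x + y) \<le> max 0 y" by auto
  then have "(max 0 (x + y))\<^sup>2 \<le> (max 0 y)\<^sup>2" by (intro power_mono) auto
  also have "\<dots> \<le> y\<^sup>2" by (auto simp: max_def)
  finally show ?thesis using False by simp
qed

text \<open>An abstract problem with Gaussian observations: each parameter \<open>\<theta> \<in> A\<close> carries a null mean \<open>m0 \<theta>\<close> and an
  alternative mean \<open>m1 \<theta>\<close>. Indexing the null by the parameters of the alternative lets the single weight \<open>L\<close>
  integrate the violations of both kinds of constraints.\<close>

locale shift_testing =
  fixes L :: "'p::euclidean_space measure" and A :: "'p set"
    and m0 m1 :: "'p \<Rightarrow> (real^'k::finite) \<times> (real^'k)" and \<alpha> :: real
  assumes \<alpha>: "0 < \<alpha>" "\<alpha> < 1"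
    and L: "finite_measure L" and sets_L [measurable_cong]: "sets L = sets borel"
    and A: "A \<noteq> {}" and AE_A: "AE \<theta> in L. \<theta> \<in> A" and supp: "full_support_on A L"
    and m0: "continuous_on UNIV m0" and m1: "continuous_on UNIV m1"
begin

sublocale L: finite_measure L by (rule L)

definition unbiased where
  "unbiased \<phi> \<longleftrightarrow> is_test \<phi> \<and> (\<forall>\<theta>\<in>A. gauss_power \<phi> (m0 \<theta>) \<le> \<alpha> \<and> \<alpha> \<le> gauss_power \<phi> (m1 \<theta>))"

definition avg_power where
  "avg_power \<phi> = (LINT \<theta>|L. gauss_power \<phi> (m1 \<theta>))"

definition optimal where
  "optimal \<phi> \<longleftrightarrow> unbiased \<phi> \<and> (\<forall>\<psi>. unbiased \<psi> \<longrightarrow> avg_power \<psi> \<le> avg_power \<phi>)"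

text \<open>The amounts by which the two constraints of unbiasedness are violated. They are also the derivatives of
  half the squared violations, which is why they reappear as the densities of the measures of a Bayes test.\<close>

definition shortfall where
  "shortfall \<phi> \<theta> = max 0 (\<alpha> - gauss_power \<phi> (m1 \<theta>))"

definition excess where
  "excess \<phi> \<theta> = max 0 (gauss_power \<phi> (m0 \<theta>) - \<alpha>)"

definition penalty where
  "penalty \<phi> = (LINT \<theta>|L. (shortfall \<phi> \<theta>)\<^sup>2 + (excess \<phi> \<theta>)\<^sup>2)"

definition penalised where
  "penalised c \<phi> = avg_power \<phi> - c / 2 * penalty \<phi>"

lemma continuous_power [continuous_intros]:
  assumes "is_test \<phi>"
  shows "continuous_on UNIV (\<lambda>\<theta>. gauss_power \<phi> (m0 \<theta>))" "continuous_on UNIV (\<lambda>\<theta>. gauss_power \<phi> (m1 \<theta>))"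
  using gauss_power_continuous[OF is_testD(1,2)[OF assms]] m0 m1 by blast+

lemma measurable_power [measurable]:
  assumes "is_test \<phi>"
  shows "(\<lambda>\<theta>. gauss_power \<phi> (m0 \<theta>)) \<in> borel_measurable borel" "(\<lambda>\<theta>. gauss_power \<phi> (m1 \<theta>)) \<in> borel_measurable borel"
  using continuous_power[OF assms] by (auto intro: borel_measurable_continuous_onI)

lemma continuous_violation:
  assumes "is_test \<phi>"
  shows "continuous_on UNIV (shortfall \<phi>)" "continuous_on UNIV (excess \<phi>)"
  unfolding shortfall_def excess_def by (intro continuous_intros assms)+

lemma measurable_violation:
  assumes "is_test \<phi>"
  shows "shortfall \<phi> \<in> borel_measurable borel" "excess \<phi> \<in> borel_measurable borel"
  using continuous_violation[OF assms] by (auto intro: borel_measurable_continuous_onI)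

lemma violation_bounds:
  assumes "is_test \<phi>"
  shows "0 \<le> shortfall \<phi> \<theta>" "shortfall \<phi> \<theta> \<le> 1" "0 \<le> excess \<phi> \<theta>" "excess \<phi> \<theta> \<le> 1"
  using gauss_power_test[OF assms, of "m0 \<theta>"] gauss_power_test[OF assms, of "m1 \<theta>"] \<alpha>
  by (auto simp: shortfall_def excess_def)

lemma integrable_bounded_L:
  fixes f :: "'p \<Rightarrow> real"
  assumes "f \<in> borel_measurable borel" "\<And>\<theta>. \<bar>f \<theta>\<bar> \<le> c"
  shows "integrable L f"
  by (rule L.integrable_const_bound[of _ c]) (use assms in \<open>auto simp: measurable_cong_sets[OF sets_L refl]\<close>)

lemma violation_sq_bounds:
  assumes "is_test \<phi>"
  shows "0 \<le> (shortfall \<phi> \<theta>)\<^sup>2 + (excess \<phi> \<theta>)\<^sup>2" "(shortfall \<phi> \<theta>)\<^sup>2 + (excess \<phi> \<theta>)\<^sup>2 \<le> 2"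
  using violation_bounds[OF assms, of \<theta>] power_le_one[of "shortfall \<phi> \<theta>" 2] power_le_one[of "excess \<phi> \<theta>" 2]
  by auto

lemma integrable_power:
  assumes "is_test \<phi>"
  shows "integrable L (\<lambda>\<theta>. gauss_power \<phi> (m0 \<theta>))" "integrable L (\<lambda>\<theta>. gauss_power \<phi> (m1 \<theta>))"
    "integrable L (\<lambda>\<theta>. (shortfall \<phi> \<theta>)\<^sup>2 + (excess \<phi> \<theta>)\<^sup>2)"
proof -
  show "integrable L (\<lambda>\<theta>. gauss_power \<phi> (m0 \<theta>))" "integrable L (\<lambda>\<theta>. gauss_power \<phi> (m1 \<theta>))"
    by (intro integrable_bounded_L[of _ 1] measurable_power gauss_power_test assms)+
  have [measurable]: "shortfall \<phi> \<in> borel_measurable borel" "excess \<phi> \<in> borel_measurable borel"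
    using measurable_violation[OF assms] .
  show "integrable L (\<lambda>\<theta>. (shortfall \<phi> \<theta>)\<^sup>2 + (excess \<phi> \<theta>)\<^sup>2)"
    using violation_sq_bounds[OF assms] by (intro integrable_bounded_L[of _ 2]) auto
qed

lemma penalty_nonneg: "is_test \<phi> \<Longrightarrow> 0 \<le> penalty \<phi>"
  unfolding penalty_def by (intro integral_nonneg_AE AE_I2 violation_sq_bounds)

lemma avg_power_le: "is_test \<phi> \<Longrightarrow> avg_power \<phi> \<le> measure L (space L)"
  using integral_mono[OF integrable_power(2), of \<phi> "\<lambda>_. 1"] gauss_power_test(2)[of \<phi>]
  by (simp add: avg_power_def)

lemma avg_power_nonneg: "is_test \<phi> \<Longrightarrow> 0 \<le> avg_power \<phi>"
  unfolding avg_power_def by (intro integral_nonneg_AE AE_I2 gauss_power_test)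

lemma avg_power_midpoint:
  assumes "is_test u" "is_test v"
  shows "avg_power (\<lambda>x. (u x + v x) / 2) = (avg_power u + avg_power v) / 2"
  using integrable_power(2)[OF assms(1)] integrable_power(2)[OF assms(2)]
  by (simp add: avg_power_def gauss_power_midpoint[OF assms])

lemma penalty_midpoint:
  assumes "is_test u" "is_test v"
  shows "penalty (\<lambda>x. (u x + v x) / 2) \<le> (penalty u + penalty v) / 2"
proof -
  let ?w = "\<lambda>x. (u x + v x) / 2"
  let ?q = "\<lambda>u \<theta>. (shortfall u \<theta>)\<^sup>2 + (excess u \<theta>)\<^sup>2"
  have "?q ?w \<theta> \<le> (?q u \<theta> + ?q v \<theta>) / 2" for \<theta>
  proof -
    have "shortfall ?w \<theta> = max 0 (((\<alpha> - gauss_power u (m1 \<theta>)) + (\<alpha> - gauss_power v (m1 \<theta>))) / 2)"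
      "excess ?w \<theta> = max 0 (((gauss_power u (m0 \<theta>) - \<alpha>) + (gauss_power v (m0 \<theta>) - \<alpha>)) / 2)"
      by (simp_all add: shortfall_def excess_def gauss_power_midpoint[OF assms] field_simps)
    then have "(shortfall ?w \<theta>)\<^sup>2 \<le> ((shortfall u \<theta>)\<^sup>2 + (shortfall v \<theta>)\<^sup>2) / 2"
      "(excess ?w \<theta>)\<^sup>2 \<le> ((excess u \<theta>)\<^sup>2 + (excess v \<theta>)\<^sup>2) / 2"
      using positive_part_sq_midpoint by (simp_all only: shortfall_def excess_def)
    then show ?thesis by (simp add: field_simps)
  qed
  then have "penalty ?w \<le> (LINT \<theta>|L. (?q u \<theta> + ?q v \<theta>) / 2)"
    unfolding penalty_def using integrable_power(3)[OF assms(1)] integrable_power(3)[OF assms(2)]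
    by (intro integral_mono integrable_power is_test_midpoint assms integrable_divide Bochner_Integration.integrable_add)
  also have "\<dots> = (penalty u + penalty v) / 2"
    unfolding penalty_def using integrable_power(3)[OF assms(1)] integrable_power(3)[OF assms(2)]
    by (simp only: integral_divide_zero Bochner_Integration.integral_add)
  finally show ?thesis .
qed

lemma
  assumes \<psi>: "\<And>n. is_test (\<psi> n)" and u: "is_test u"
    and lim: "AE x in lborel. (\<lambda>n. \<psi> n x) \<longlonglongrightarrow> u x"
  shows avg_power_tendsto: "(\<lambda>n. avg_power (\<psi> n)) \<longlonglongrightarrow> avg_power u"
    and penalty_tendsto: "(\<lambda>n. penalty (\<psi> n)) \<longlonglongrightarrow> penalty u"
    and unbiased_limit: "(\<And>n. unbiased (\<psi> n)) \<Longrightarrow> unbiased u"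
proof -
  have g: "(\<lambda>n. gauss_power (\<psi> n) m) \<longlonglongrightarrow> gauss_power u m" for m
    by (rule gauss_power_tendsto_test[OF \<psi> u lim])
  show "(\<lambda>n. avg_power (\<psi> n)) \<longlonglongrightarrow> avg_power u"
    unfolding avg_power_def
  proof (rule integral_dominated_convergence[of _ _ _ "\<lambda>_. 1"])
    show "AE \<theta> in L. (\<lambda>n. gauss_power (\<psi> n) (m1 \<theta>)) \<longlonglongrightarrow> gauss_power u (m1 \<theta>)" using g by blast
    show "AE \<theta> in L. norm (gauss_power (\<psi> n) (m1 \<theta>)) \<le> 1" for n
      by (intro AE_I2) (simp add: gauss_power_test[OF \<psi>])
  qed (use integrable_power(2)[OF u] integrable_power(2)[OF \<psi>] in auto)
  show "(\<lambda>n. penalty (\<psi> n)) \<longlonglongrightarrow> penalty u"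
    unfolding penalty_def
  proof (rule integral_dominated_convergence[of _ _ _ "\<lambda>_. 2"])
    show "AE \<theta> in L. (\<lambda>n. (shortfall (\<psi> n) \<theta>)\<^sup>2 + (excess (\<psi> n) \<theta>)\<^sup>2) \<longlonglongrightarrow> (shortfall u \<theta>)\<^sup>2 + (excess u \<theta>)\<^sup>2"
      unfolding shortfall_def excess_def by (intro AE_I2 tendsto_intros g)
    show "AE \<theta> in L. norm ((shortfall (\<psi> n) \<theta>)\<^sup>2 + (excess (\<psi> n) \<theta>)\<^sup>2) \<le> 2" for n
      using violation_sq_bounds[OF \<psi>] by (intro AE_I2) (simp add: abs_of_nonneg)
  qed (use integrable_power(3)[OF u] integrable_power(3)[OF \<psi>] in auto)
  show "unbiased u" if "\<And>n. unbiased (\<psi> n)"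
    unfolding unbiased_def
  proof (intro conjI ballI u)
    fix \<theta> assume "\<theta> \<in> A"
    then have "gauss_power (\<psi> n) (m0 \<theta>) \<le> \<alpha>" "\<alpha> \<le> gauss_power (\<psi> n) (m1 \<theta>)" for n
      using that[of n] by (auto simp: unbiased_def)
    then show "gauss_power u (m0 \<theta>) \<le> \<alpha>" "\<alpha> \<le> gauss_power u (m1 \<theta>)"
      using LIMSEQ_le_const2[OF g] LIMSEQ_le_const[OF g] by blast+
  qed
qed

lemma unbiased_test: "unbiased \<phi> \<Longrightarrow> is_test \<phi>"
  by (simp add: unbiased_def)

lemma unbiased_midpoint:
  assumes "unbiased u" "unbiased v"
  shows "unbiased (\<lambda>x. (u x + v x) / 2)"
  unfolding unbiased_def
proof (intro conjI ballI)
  have t: "is_test u" "is_test v" using assms by (auto simp: unbiased_def)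
  show "is_test (\<lambda>x. (u x + v x) / 2)" by (rule is_test_midpoint[OF t])
  fix \<theta> assume \<theta>: "\<theta> \<in> A"
  have "gauss_power u (m0 \<theta>) \<le> \<alpha>" "\<alpha> \<le> gauss_power u (m1 \<theta>)"
    "gauss_power v (m0 \<theta>) \<le> \<alpha>" "\<alpha> \<le> gauss_power v (m1 \<theta>)"
    using assms \<theta> by (auto simp: unbiased_def)
  then show "gauss_power (\<lambda>x. (u x + v x) / 2) (m0 \<theta>) \<le> \<alpha>"
    "\<alpha> \<le> gauss_power (\<lambda>x. (u x + v x) / 2) (m1 \<theta>)"
    by (simp_all add: gauss_power_midpoint[OF t])
qed

theorem optimal_exists: "\<exists>\<phi>. optimal \<phi>"
proof -
  have "\<exists>\<phi>\<in>Collect unbiased. \<forall>\<psi>\<in>Collect unbiased. avg_power \<psi> \<le> avg_power \<phi>"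
  proof (rule maximum_attained_on_tests)
    have "unbiased (\<lambda>_. \<alpha>)" using \<alpha> by (simp add: unbiased_def is_test_def gauss_power_const)
    then show "Collect unbiased \<noteq> {}" by blast
    show "bdd_above (avg_power ` Collect unbiased)"
      using avg_power_le unbiased_test by (intro bdd_aboveI2) auto
    show "u \<in> Collect unbiased"
      if "\<And>n. \<psi> n \<in> Collect unbiased" "is_test u" "AE x in lborel. (\<lambda>n. \<psi> n x) \<longlonglongrightarrow> u x" for \<psi> u
      using that unbiased_limit[of \<psi> u] unbiased_test by simp
  qed (auto simp: unbiased_midpoint unbiased_test avg_power_midpoint intro: avg_power_tendsto)
  then show ?thesis by (auto simp: optimal_def)
qed

lemma penalised_maximiser_exists:
  assumes "c \<ge> 0"
  shows "\<exists>\<phi>. is_test \<phi> \<and> (\<forall>\<psi>. is_test \<psi> \<longrightarrow> penalised c \<psi> \<le> penalised c \<phi>)"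
proof -
  have "\<exists>\<phi>\<in>Collect is_test. \<forall>\<psi>\<in>Collect is_test. penalised c \<psi> \<le> penalised c \<phi>"
  proof (rule maximum_attained_on_tests)
    have "is_test (\<lambda>_. \<alpha>)" using \<alpha> by (simp add: is_test_def)
    then show "Collect is_test \<noteq> {}" by blast
    show "bdd_above (penalised c ` Collect is_test)"
    proof (rule bdd_aboveI2)
      fix \<phi> :: "(real^'k) \<times> (real^'k) \<Rightarrow> real" assume "\<phi> \<in> Collect is_test"
      then have "is_test \<phi>" by simp
      then show "penalised c \<phi> \<le> measure L (space L)"
        using avg_power_le[of \<phi>] penalty_nonneg[of \<phi>] assms
        by (simp add: penalised_def) (metis add_increasing2 diff_le_eq mult_nonneg_nonneg zero_le_divide_iff zero_le_numeral)
    qed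
    show "(penalised c u + penalised c v) / 2 \<le> penalised c (\<lambda>x. (u x + v x) / 2)"
      if "u \<in> Collect is_test" "v \<in> Collect is_test" for u v
      using avg_power_midpoint[of u v] that assms mult_left_mono[OF penalty_midpoint[of u v], of "c / 2"]
      by (simp add: penalised_def field_simps)
    show "(\<lambda>n. penalised c (\<psi> n)) \<longlonglongrightarrow> penalised c u"
      if "\<And>n. is_test (\<psi> n)" "is_test u" "AE x in lborel. (\<lambda>n. \<psi> n x) \<longlonglongrightarrow> u x" for \<psi> u
      unfolding penalised_def by (intro tendsto_intros avg_power_tendsto penalty_tendsto that)
  qed (auto intro: is_test_midpoint)
  then show ?thesis by auto
qed

text \<open>The derivative of the penalised power at a maximiser, in the direction of any other test, is at most zero.
  The power of \<open>(1 - t) \<phi> + t \<psi>\<close> is affine in \<open>t\<close>, so \<open>positive_part_sq_add\<close> bounds the penalty along this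
  segment up to a multiple of \<open>t\<^sup>2\<close>; dividing by \<open>t\<close> and letting \<open>t\<close> tend to zero gives the claim.\<close>

lemma penalised_first_order:
  assumes c: "c \<ge> 0" and \<phi>: "is_test \<phi>" and mx: "\<And>\<psi>. is_test \<psi> \<Longrightarrow> penalised c \<psi> \<le> penalised c \<phi>"
    and \<psi>: "is_test \<psi>"
  shows "(LINT \<theta>|L. (1 + c * shortfall \<phi> \<theta>) * (gauss_power \<psi> (m1 \<theta>) - gauss_power \<phi> (m1 \<theta>)))
    - (LINT \<theta>|L. c * excess \<phi> \<theta> * (gauss_power \<psi> (m0 \<theta>) - gauss_power \<phi> (m0 \<theta>))) \<le> 0"
    (is "?I1 - ?I0 \<le> 0")
proof -
  define D1 where "D1 \<theta> = gauss_power \<psi> (m1 \<theta>) - gauss_power \<phi> (m1 \<theta>)" for \<theta>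
  define D0 where "D0 \<theta> = gauss_power \<psi> (m0 \<theta>) - gauss_power \<phi> (m0 \<theta>)" for \<theta>
  have [measurable]: "D1 \<in> borel_measurable borel" "D0 \<in> borel_measurable borel"
    "shortfall \<phi> \<in> borel_measurable borel" "excess \<phi> \<in> borel_measurable borel"
    unfolding D1_def D0_def using measurable_power[OF \<phi>] measurable_power[OF \<psi>] measurable_violation[OF \<phi>] by measurable
  have D: "\<bar>D1 \<theta>\<bar> \<le> 1" "\<bar>D0 \<theta>\<bar> \<le> 1" for \<theta>
    using gauss_power_test[OF \<phi>, of "m0 \<theta>"] gauss_power_test[OF \<psi>, of "m0 \<theta>"]
      gauss_power_test[OF \<phi>, of "m1 \<theta>"] gauss_power_test[OF \<psi>, of "m1 \<theta>"]
    by (simp_all add: D1_def D0_def abs_le_iff)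
  have D_sq: "(D1 \<theta>)\<^sup>2 + (D0 \<theta>)\<^sup>2 \<le> 2" for \<theta>
    using D[of \<theta>] abs_square_le_1[of "D1 \<theta>"] abs_square_le_1[of "D0 \<theta>"] by linarith
  have prod_le: "\<bar>shortfall \<phi> \<theta> * D1 \<theta>\<bar> \<le> 1" "\<bar>excess \<phi> \<theta> * D0 \<theta>\<bar> \<le> 1" for \<theta>
    using D[of \<theta>] violation_bounds[OF \<phi>, of \<theta>] by (auto simp: abs_mult intro!: mult_le_one)
  have int: "integrable L D1" "integrable L (\<lambda>\<theta>. shortfall \<phi> \<theta> * D1 \<theta>)" "integrable L (\<lambda>\<theta>. excess \<phi> \<theta> * D0 \<theta>)"
    using D prod_le by (auto intro!: integrable_bounded_L[of _ 1])
  let ?G1 = "LINT \<theta>|L. shortfall \<phi> \<theta> * D1 \<theta>" and ?G0 = "LINT \<theta>|L. excess \<phi> \<theta> * D0 \<theta>"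
  let ?\<mu> = "measure L (space L)"
  have main: "?I1 - ?I0 \<le> c * ?\<mu> * t" if t: "0 < t" "t \<le> 1" for t
  proof -
    define \<xi> where "\<xi> x = (1 - t) * \<phi> x + t * \<psi> x" for x
    have "is_test \<xi>"
      unfolding is_test_def
    proof (intro conjI allI)
      show "\<xi> \<in> borel_measurable borel"
        unfolding \<xi>_def using is_testD(1)[OF \<phi>] is_testD(1)[OF \<psi>] by measurable
      show "0 \<le> \<xi> x" "\<xi> x \<le> 1" for x
        unfolding \<xi>_def using t is_testD(3,4)[OF \<phi>, of x] is_testD(3,4)[OF \<psi>, of x]
        by (auto intro!: add_nonneg_nonneg convex_bound_le)
    qed
    have \<xi>: "gauss_power \<xi> m = gauss_power \<phi> m + t * (gauss_power \<psi> m - gauss_power \<phi> m)" for m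
      unfolding \<xi>_def
      by (subst gauss_power_add[OF is_testD(1,2)[OF \<phi>] is_testD(1,2)[OF \<psi>]]) (simp add: algebra_simps)
    have "penalty \<xi> \<le> (LINT \<theta>|L. ((shortfall \<phi> \<theta>)\<^sup>2 + (excess \<phi> \<theta>)\<^sup>2)
        + (2 * t * (excess \<phi> \<theta> * D0 \<theta> - shortfall \<phi> \<theta> * D1 \<theta>) + 2 * t\<^sup>2))"
      unfolding penalty_def
    proof (intro integral_mono integrable_power \<open>is_test \<xi>\<close>)
      fix \<theta>
      have "(shortfall \<xi> \<theta>)\<^sup>2 \<le> (shortfall \<phi> \<theta>)\<^sup>2 + 2 * (- t * D1 \<theta>) * shortfall \<phi> \<theta> + (- t * D1 \<theta>)\<^sup>2"
        using positive_part_sq_add[of "\<alpha> - gauss_power \<phi> (m1 \<theta>)" "- t * D1 \<theta>"]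
        by (simp add: shortfall_def \<xi> D1_def algebra_simps)
      moreover have "(excess \<xi> \<theta>)\<^sup>2 \<le> (excess \<phi> \<theta>)\<^sup>2 + 2 * (t * D0 \<theta>) * excess \<phi> \<theta> + (t * D0 \<theta>)\<^sup>2"
        using positive_part_sq_add[of "gauss_power \<phi> (m0 \<theta>) - \<alpha>" "t * D0 \<theta>"]
        by (simp add: excess_def \<xi> D0_def algebra_simps)
      moreover have "t\<^sup>2 * ((D1 \<theta>)\<^sup>2 + (D0 \<theta>)\<^sup>2) \<le> t\<^sup>2 * 2" using D_sq by (intro mult_left_mono) auto
      ultimately show "(shortfall \<xi> \<theta>)\<^sup>2 + (excess \<xi> \<theta>)\<^sup>2 \<le> ((shortfall \<phi> \<theta>)\<^sup>2 + (excess \<phi> \<theta>)\<^sup>2)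
        + (2 * t * (excess \<phi> \<theta> * D0 \<theta> - shortfall \<phi> \<theta> * D1 \<theta>) + 2 * t\<^sup>2)"
        by (simp add: power_mult_distrib algebra_simps)
    qed (use integrable_power(3)[OF \<phi>] int in auto)
    also have "\<dots> = penalty \<phi> + 2 * t * (?G0 - ?G1) + 2 * t\<^sup>2 * ?\<mu>"
      using integrable_power(3)[OF \<phi>] int by (simp add: penalty_def)
    finally have pen: "penalty \<xi> \<le> penalty \<phi> + 2 * t * (?G0 - ?G1) + 2 * t\<^sup>2 * ?\<mu>" .
    have avg: "avg_power \<xi> = avg_power \<phi> + t * (LINT \<theta>|L. D1 \<theta>)"
      unfolding avg_power_def \<xi> D1_def[symmetric]
      using integrable_power(2)[OF \<phi>] int by simp
    have "c / 2 * penalty \<xi> \<le> c / 2 * (penalty \<phi> + 2 * t * (?G0 - ?G1) + 2 * t\<^sup>2 * ?\<mu>)"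
      using c by (intro mult_left_mono[OF pen]) auto
    then have "t * ((LINT \<theta>|L. D1 \<theta>) + c * ?G1 - c * ?G0) \<le> t * (c * ?\<mu> * t)"
      using mx[OF \<open>is_test \<xi>\<close>] unfolding penalised_def avg by (simp add: power2_eq_square algebra_simps)
    then have "(LINT \<theta>|L. D1 \<theta>) + c * ?G1 - c * ?G0 \<le> c * ?\<mu> * t" using t by simp
    moreover have "?I1 = (LINT \<theta>|L. D1 \<theta>) + c * ?G1"
      unfolding D1_def[symmetric] distrib_right mult_1 mult.assoc using int by simp
    moreover have "?I0 = c * ?G0"
      unfolding D0_def[symmetric] mult.assoc by simp
    ultimately show ?thesis by simp
  qed
  have "?I1 - ?I0 \<le> c * ?\<mu> * 0"
  proof (rule LIMSEQ_le_const)
    show "(\<lambda>n. c * ?\<mu> * (1 / real (Suc n))) \<longlonglongrightarrow> c * ?\<mu> * 0"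
      by (intro tendsto_intros LIMSEQ_Suc[OF lim_1_over_n])
    show "\<exists>N. \<forall>n\<ge>N. ?I1 - ?I0 \<le> c * ?\<mu> * (1 / real (Suc n))"
      by (intro exI allI impI main) auto
  qed
  then show ?thesis by simp
qed

end

section \<open>Penalised maximisers are Bayes tests and converge\<close>

context shift_testing
begin

text \<open>The mixture densities that the first order condition of the penalised problem compares: integrated against
  \<open>\<psi> - \<phi>\<close>, their difference is the directional derivative in \<open>penalised_first_order\<close>.\<close>

definition alt_mix where
  "alt_mix c \<phi> x = (LINT \<theta>|L. (1 + c * shortfall \<phi> \<theta>) * gauss (m1 \<theta>) x)"

definition null_mix where
  "null_mix c \<phi> x = (LINT \<theta>|L. (c * excess \<phi> \<theta>) * gauss (m0 \<theta>) x)"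

lemma L_nonzero: "emeasure L (space L) \<noteq> 0"
proof -
  have "emeasure L UNIV > 0" using supp A unfolding full_support_on_def by auto
  then show ?thesis using sets_eq_imp_space_eq[OF sets_L] by simp
qed

text \<open>By the first order condition and Fubini's theorem a maximiser also maximises the integral of \<open>\<psi>\<close> against
  \<open>alt_mix - null_mix\<close> over all tests \<open>\<psi>\<close>, so almost everywhere it rejects where this difference is positive
  and accepts where it is negative. Changing it on a null set makes this true everywhere and does not affect
  its powers, hence neither the mixtures.
  The last conclusion says that the measure on the null is nonzero: otherwise the test would always reject,
  and its excess would be \<open>1 - \<alpha>\<close>.\<close>

lemma bayes_penalised_maximiser_exists:
  assumes c: "c > 0"
  shows "\<exists>\<phi>. is_test \<phi> \<and> (\<forall>\<psi>. is_test \<psi> \<longrightarrow> penalised c \<psi> \<le> penalised c \<phi>) \<and>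
    (\<forall>x. null_mix c \<phi> x < alt_mix c \<phi> x \<longrightarrow> \<phi> x = 1) \<and>
    (\<forall>x. alt_mix c \<phi> x < null_mix c \<phi> x \<longrightarrow> \<phi> x = 0) \<and>
    0 < (LINT \<theta>|L. excess \<phi> \<theta>)"
proof -
  obtain \<phi>0 where \<phi>0: "is_test \<phi>0" and mx0: "\<And>\<psi>. is_test \<psi> \<Longrightarrow> penalised c \<psi> \<le> penalised c \<phi>0"
    using penalised_maximiser_exists[of c] c by auto
  define q where "q x = alt_mix c \<phi>0 x - null_mix c \<phi>0 x" for x
  define \<phi> where "\<phi> x = (if q x > 0 then 1 else if q x < 0 then 0 else \<phi>0 x)" for x
  have w: "(\<lambda>\<theta>. 1 + c * shortfall \<phi>0 \<theta>) \<in> borel_measurable borel" "\<bar>1 + c * shortfall \<phi>0 \<theta>\<bar> \<le> 1 + c"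
    "(\<lambda>\<theta>. c * excess \<phi>0 \<theta>) \<in> borel_measurable borel" "\<bar>c * excess \<phi>0 \<theta>\<bar> \<le> c" for \<theta>
    using measurable_violation[OF \<phi>0] violation_bounds[OF \<phi>0, of \<theta>] c
    by (auto intro!: mult_left_le simp: abs_of_nonneg)
  note mix1 = gauss_power_mixture[OF L sets_L m1 _ _ w(1,2), folded alt_mix_def]
  note mix0 = gauss_power_mixture[OF L sets_L m0 _ _ w(3,4), folded null_mix_def]
  have [measurable]: "alt_mix c \<phi>0 \<in> borel_measurable borel" "null_mix c \<phi>0 \<in> borel_measurable borel"
    using mix1(1)[of "\<lambda>_. 1" 1] mix0(1)[of "\<lambda>_. 1" 1] by (auto dest: borel_measurable_integrable)
  have [measurable]: "q \<in> borel_measurable borel" unfolding q_def by measurable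
  have [measurable]: "\<phi>0 \<in> borel_measurable borel" using is_testD(1)[OF \<phi>0] .
  have \<phi>: "is_test \<phi>"
    unfolding is_test_def
  proof (intro conjI allI)
    show "\<phi> \<in> borel_measurable borel" unfolding \<phi>_def by measurable
    show "0 \<le> \<phi> x" "\<phi> x \<le> 1" for x using is_testD(3,4)[OF \<phi>0, of x] by (auto simp: \<phi>_def)
  qed
  \<comment> \<open>Written as a linear combination to match the linearity of the power.\<close>
  define \<delta> where "\<delta> x = 1 * \<phi> x + (-1) * \<phi>0 x" for x
  have \<delta>m: "\<delta> \<in> borel_measurable borel"
    unfolding \<delta>_def using is_testD(1)[OF \<phi>] is_testD(1)[OF \<phi>0] by measurable
  have \<delta>b: "\<bar>\<delta> x\<bar> \<le> 1" for x
    using is_testD(3,4)[OF \<phi>, of x] is_testD(3,4)[OF \<phi>0, of x] by (simp add: \<delta>_def abs_le_iff)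
  have g\<delta>: "gauss_power \<delta> m = gauss_power \<phi> m - gauss_power \<phi>0 m" for m
    unfolding \<delta>_def by (subst gauss_power_add[OF is_testD(1,2)[OF \<phi>] is_testD(1,2)[OF \<phi>0]]) simp
  have int: "integrable lborel (\<lambda>x. \<delta> x * alt_mix c \<phi>0 x)" "integrable lborel (\<lambda>x. \<delta> x * null_mix c \<phi>0 x)"
    using mix1(1)[OF \<delta>m \<delta>b] mix0(1)[OF \<delta>m \<delta>b] .
  have "(LINT x|lborel. \<delta> x * alt_mix c \<phi>0 x) - (LINT x|lborel. \<delta> x * null_mix c \<phi>0 x) \<le> 0"
    unfolding mix1(2)[OF \<delta>m \<delta>b] mix0(2)[OF \<delta>m \<delta>b] g\<delta>
    using penalised_first_order[OF less_imp_le[OF c] \<phi>0 mx0 \<phi>] by simp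
  then have "(LINT x|lborel. \<delta> x * q x) \<le> 0"
    using int by (simp add: q_def right_diff_distrib)
  moreover have \<delta>q: "0 \<le> \<delta> x * q x" for x
    using is_testD(3,4)[OF \<phi>0, of x]
    by (auto simp: \<delta>_def \<phi>_def mult_nonpos_nonpos)
  moreover have "0 \<le> (LINT x|lborel. \<delta> x * q x)" by (intro integral_nonneg_AE AE_I2 \<delta>q)
  ultimately have "(LINT x|lborel. \<delta> x * q x) = 0" by simp
  moreover have "integrable lborel (\<lambda>x. \<delta> x * q x)"
    using int by (simp add: q_def right_diff_distrib)
  ultimately have "AE x in lborel. \<delta> x * q x = 0"
    by (subst integral_nonneg_eq_0_iff_AE[symmetric]) (auto intro!: AE_I2 \<delta>q)
  then have AE_eq: "AE x in lborel. \<phi> x = \<phi>0 x"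
    by eventually_elim (auto simp: \<delta>_def \<phi>_def split: if_splits)
  have "gauss_power \<phi> m = gauss_power \<phi>0 m" for m
    using gauss_power_cong_AE[OF is_testD(1)[OF \<phi>] is_testD(1)[OF \<phi>0] AE_eq] .
  then have same: "shortfall \<phi> = shortfall \<phi>0" "excess \<phi> = excess \<phi>0" "penalised c \<phi> = penalised c \<phi>0"
    by (auto simp: shortfall_def excess_def penalised_def penalty_def avg_power_def fun_eq_iff)
  then have mix: "alt_mix c \<phi> = alt_mix c \<phi>0" "null_mix c \<phi> = null_mix c \<phi>0"
    by (auto simp: alt_mix_def null_mix_def fun_eq_iff)
  have int_ex: "integrable L (excess \<phi>)"
    using violation_bounds[OF \<phi>] measurable_violation[OF \<phi>] by (intro integrable_bounded_L[of _ 1]) auto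
  have "0 < (LINT \<theta>|L. excess \<phi> \<theta>)"
  proof (rule ccontr)
    assume "\<not> ?thesis"
    moreover have "0 \<le> (LINT \<theta>|L. excess \<phi> \<theta>)"
      by (intro integral_nonneg_AE AE_I2 violation_bounds \<phi>)
    ultimately have "(LINT \<theta>|L. excess \<phi> \<theta>) = 0" by simp
    then have ex0: "AE \<theta> in L. excess \<phi> \<theta> = 0"
      using integral_nonneg_eq_0_iff_AE[OF int_ex] violation_bounds(3)[OF \<phi>] by simp
    have "q x > 0" for x
    proof -
      have "null_mix c \<phi> x = 0"
        unfolding null_mix_def by (rule integral_eq_zero_AE) (use ex0 in eventually_elim, simp)
      moreover have "(LINT \<theta>|L. 0) < alt_mix c \<phi> x"
        unfolding alt_mix_def
      proof (rule L.integral_less_AE_space)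
        have "integrable L (\<lambda>\<theta>. (1 + c * shortfall \<phi>0 \<theta>) * gauss (m1 \<theta>) x)"
        proof (rule integrable_bounded_L)
          have "(\<lambda>\<theta>. gauss (m1 \<theta>) x) \<in> borel_measurable borel"
            by (intro borel_measurable_continuous_onI continuous_on_gauss m1 continuous_on_const)
          then show "(\<lambda>\<theta>. (1 + c * shortfall \<phi>0 \<theta>) * gauss (m1 \<theta>) x) \<in> borel_measurable borel"
            using w(1) by measurable
          have "\<bar>gauss m x\<bar> \<le> 1 / sqrt (2 * pi) ^ DIM((real^'k) \<times> (real^'k))" for m
            by (simp add: gauss_def divide_right_mono)
          then show "\<bar>(1 + c * shortfall \<phi>0 \<theta>) * gauss (m1 \<theta>) x\<bar>
              \<le> (1 + c) * (1 / sqrt (2 * pi) ^ DIM((real^'k) \<times> (real^'k)))" for \<theta>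
            unfolding abs_mult using w(2)[of \<theta>] c by (intro mult_mono) auto
        qed
        then show "integrable L (\<lambda>\<theta>. (1 + c * shortfall \<phi> \<theta>) * gauss (m1 \<theta>) x)" by (simp add: same)
        show "AE \<theta> in L. 0 < (1 + c * shortfall \<phi> \<theta>) * gauss (m1 \<theta>) x"
          using violation_bounds(1)[OF \<phi>] c gauss_pos
          by (intro AE_I2 mult_pos_pos add_pos_nonneg mult_nonneg_nonneg) (auto simp: less_imp_le)
      qed (use L_nonzero in auto)
      ultimately show ?thesis by (simp add: q_def mix)
    qed
    then have "\<phi> = (\<lambda>_. 1)" by (auto simp: \<phi>_def)
    then have "excess \<phi> \<theta> = 1 - \<alpha>" for \<theta> using \<alpha> by (simp add: excess_def gauss_power_const)
    then have "AE \<theta> in L. False" using ex0 \<alpha> by simp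
    then show False using L_nonzero by (simp add: AE_iff_null null_sets_def)
  qed
  then show ?thesis
    using \<phi> mx0 same mix
    by (intro exI[of _ \<phi>]) (auto simp: \<phi>_def q_def)
qed

lemma penalty_unbiased:
  assumes "unbiased \<phi>"
  shows "penalty \<phi> = 0"
  unfolding penalty_def
proof (rule integral_eq_zero_AE)
  show "AE \<theta> in L. (shortfall \<phi> \<theta>)\<^sup>2 + (excess \<phi> \<theta>)\<^sup>2 = 0"
    using AE_A by eventually_elim (use assms in \<open>auto simp: unbiased_def shortfall_def excess_def max_def\<close>)
qed

lemma unbiased_if_penalty_zero:
  assumes \<phi>: "is_test \<phi>" and "penalty \<phi> \<le> 0"
  shows "unbiased \<phi>"
  unfolding unbiased_def
proof (intro conjI ballI \<phi>)
  fix \<theta> assume \<theta>: "\<theta> \<in> A"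
  have "(shortfall \<phi> \<theta>)\<^sup>2 + (excess \<phi> \<theta>)\<^sup>2 = 0"
  proof (rule full_support_integral_zero[OF L sets_L AE_A supp, where c = 2])
    show "continuous_on UNIV (\<lambda>\<theta>. (shortfall \<phi> \<theta>)\<^sup>2 + (excess \<phi> \<theta>)\<^sup>2)"
      using continuous_violation[OF \<phi>] by (intro continuous_intros)
    show "\<bar>(shortfall \<phi> \<theta>)\<^sup>2 + (excess \<phi> \<theta>)\<^sup>2\<bar> \<le> 2" for \<theta>
      using violation_sq_bounds[OF \<phi>, of \<theta>] by (simp only: abs_of_nonneg)
  qed (use assms(2) \<theta> in \<open>auto simp: penalty_def\<close>)
  then have "shortfall \<phi> \<theta> = 0" "excess \<phi> \<theta> = 0" by (auto simp: sum_power2_eq_zero_iff)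
  then show "gauss_power \<phi> (m0 \<theta>) \<le> \<alpha>" "\<alpha> \<le> gauss_power \<phi> (m1 \<theta>)"
    by (auto simp: shortfall_def excess_def max_def split: if_splits)
qed

text \<open>Comparing \<open>\<psi> n\<close> with \<open>\<phi>\<close> shows that its average power is at least that of \<open>\<phi>\<close> and that its penalty is
  of order \<open>1 / n\<close>. If the integrals against some \<open>g\<close> stayed away from that of \<open>\<phi>\<close>, infinitely often on the
  same side, the tests sharing these three properties would form midpoint-convex sets; an almost everywhere
  limit of their elements would be unbiased and optimal, but would differ from \<open>\<phi>\<close>.\<close>

lemma penalised_maximisers_converge:
  assumes \<phi>: "optimal \<phi>" and uniq: "\<And>\<psi>. optimal \<psi> \<Longrightarrow> AE x in lborel. \<psi> x = \<phi> x"
    and test: "\<And>n. is_test (\<psi> n)"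
    and mx: "\<And>n u. is_test u \<Longrightarrow> penalised (real (Suc n)) u \<le> penalised (real (Suc n)) (\<psi> n)"
  shows "weak_star_converges \<psi> \<phi>"
proof -
  have t\<phi>: "is_test \<phi>" "unbiased \<phi>" using \<phi> by (auto simp: optimal_def unbiased_def)
  define C where "C = measure L (space L)"
  have key: "avg_power \<phi> \<le> avg_power (\<psi> n)" "penalty (\<psi> n) \<le> 2 * C / real (Suc n)" for n
  proof -
    have "avg_power \<phi> \<le> avg_power (\<psi> n) - real (Suc n) / 2 * penalty (\<psi> n)"
      using mx[OF t\<phi>(1), of n] penalty_unbiased[OF t\<phi>(2)] by (simp add: penalised_def)
    moreover have "0 \<le> real (Suc n) / 2 * penalty (\<psi> n)" using penalty_nonneg[OF test] by simp
    ultimately show "avg_power \<phi> \<le> avg_power (\<psi> n)" by linarith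
    have "real (Suc n) / 2 * penalty (\<psi> n) \<le> C"
      using \<open>avg_power \<phi> \<le> avg_power (\<psi> n) - _\<close> avg_power_nonneg[OF t\<phi>(1)] avg_power_le[OF test, of n]
      unfolding C_def by linarith
    then show "penalty (\<psi> n) \<le> 2 * C / real (Suc n)" by (simp add: field_simps)
  qed
  \<comment> \<open>One side suffices: the other one is the same statement for - g.\<close>
  have claim: "\<forall>\<^sub>F n in sequentially. (LINT x|lborel. \<psi> n x * g x) < (LINT x|lborel. \<phi> x * g x) + e"
    if g: "integrable lborel g" and e: "e > 0" for g e
  proof (rule ccontr)
    assume "\<not> ?thesis"
    then have freq: "\<exists>n\<ge>j. (LINT x|lborel. \<phi> x * g x) + e \<le> (LINT x|lborel. \<psi> n x * g x)" for j
      by (auto simp: eventually_sequentially not_less)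
    define K where "K j = {u. is_test u \<and> penalty u \<le> 2 * C / real (Suc j) \<and> avg_power \<phi> \<le> avg_power u \<and>
      (LINT x|lborel. \<phi> x * g x) + e \<le> (LINT x|lborel. u x * g x)}" for j
    have "\<exists>\<psi> u. (\<forall>n. \<psi> n \<in> K n) \<and> is_test u \<and> (AE x in lborel. (\<lambda>n. \<psi> n x) \<longlonglongrightarrow> u x)"
    proof (rule tests_AE_compact)
      have dec: "2 * C / real (Suc n) \<le> 2 * C / real (Suc j)" if "j \<le> n" for j n
        using that by (intro divide_left_mono) (auto simp: C_def)
      fix j
      obtain n where "n \<ge> j" "(LINT x|lborel. \<phi> x * g x) + e \<le> (LINT x|lborel. \<psi> n x * g x)"
        using freq by blast
      then have "\<psi> n \<in> K j" using key[of n] test dec[of j n] by (auto simp: K_def)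
      then show "K j \<noteq> {}" by blast
      show "K (Suc j) \<subseteq> K j" using dec[of j "Suc j"] by (auto simp: K_def)
      show "is_test u" if "u \<in> K j" for u using that by (simp add: K_def)
      show "(\<lambda>x. (u x + v x) / 2) \<in> K j" if uv: "u \<in> K j" "v \<in> K j" for u v
      proof -
        have t: "is_test u" "is_test v" using uv by (auto simp: K_def)
        have "(LINT x|lborel. (u x + v x) / 2 * g x)
            = ((LINT x|lborel. u x * g x) + (LINT x|lborel. v x * g x)) / 2"
          using test_integrable[OF t(1) g] test_integrable[OF t(2) g]
          by (simp add: add_divide_distrib distrib_right)
        then show ?thesis
          using uv penalty_midpoint[OF t] avg_power_midpoint[OF t] is_test_midpoint[OF t]
          by (auto simp: K_def)
      qed
    qed
    then obtain \<xi> u where \<xi>: "\<And>n. \<xi> n \<in> K n" and u: "is_test u"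
      and lim: "AE x in lborel. (\<lambda>n. \<xi> n x) \<longlonglongrightarrow> u x" by blast
    have t\<xi>: "is_test (\<xi> n)" for n using \<xi>[of n] by (simp add: K_def)
    have "penalty u \<le> 0"
    proof (rule LIMSEQ_le)
      show "(\<lambda>n. penalty (\<xi> n)) \<longlonglongrightarrow> penalty u" by (rule penalty_tendsto[OF t\<xi> u lim])
      have "(\<lambda>n. 2 * C * (1 / real (Suc n))) \<longlonglongrightarrow> 2 * C * 0"
        by (intro tendsto_intros LIMSEQ_Suc[OF lim_1_over_n])
      then show "(\<lambda>n. 2 * C / real (Suc n)) \<longlonglongrightarrow> 0" by simp
      show "\<exists>N. \<forall>n\<ge>N. penalty (\<xi> n) \<le> 2 * C / real (Suc n)" using \<xi> by (auto simp: K_def)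
    qed
    then have "unbiased u" by (rule unbiased_if_penalty_zero[OF u])
    moreover have "avg_power \<phi> \<le> avg_power u"
      using \<xi> by (intro LIMSEQ_le_const[OF avg_power_tendsto[OF t\<xi> u lim]]) (auto simp: K_def)
    ultimately have "optimal u" using \<phi> by (fastforce simp: optimal_def)
    then have "AE x in lborel. u x = \<phi> x" by (rule uniq)
    then have "(LINT x|lborel. u x * g x) = (LINT x|lborel. \<phi> x * g x)"
      using test_integrable[OF u g] test_integrable[OF t\<phi>(1) g] by (intro integral_cong_AE) auto
    moreover have "(LINT x|lborel. \<phi> x * g x) + e \<le> (LINT x|lborel. u x * g x)"
      using \<xi> by (intro LIMSEQ_le_const[OF test_integral_tendsto[OF t\<xi> u lim g]]) (auto simp: K_def)
    ultimately show False using e by simp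
  qed
  show ?thesis
    unfolding weak_star_converges_def
  proof (intro allI impI)
    fix g :: "(real^'k) \<times> (real^'k) \<Rightarrow> real" assume g: "integrable lborel g"
    show "(\<lambda>n. LINT x|lborel. \<psi> n x * g x) \<longlonglongrightarrow> (LINT x|lborel. \<phi> x * g x)"
    proof (rule order_tendstoI)
      fix a assume "(LINT x|lborel. \<phi> x * g x) < a"
      then show "\<forall>\<^sub>F n in sequentially. (LINT x|lborel. \<psi> n x * g x) < a"
        using claim[OF g, of "a - (LINT x|lborel. \<phi> x * g x)"] by simp
    next
      fix a assume "a < (LINT x|lborel. \<phi> x * g x)"
      then show "\<forall>\<^sub>F n in sequentially. a < (LINT x|lborel. \<psi> n x * g x)"
        using claim[of "\<lambda>x. - g x" "(LINT x|lborel. \<phi> x * g x) - a"] g by simp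
    qed
  qed
qed

end

section \<open>Uniqueness of the optimal test\<close>

lemma lborel_integral_translate:
  fixes f :: "'a::euclidean_space \<Rightarrow> real"
  assumes [measurable]: "f \<in> borel_measurable borel"
  shows "(LINT x|lborel. f (s + x)) = (LINT x|lborel. f x)"
    and "integrable lborel (\<lambda>x. f (s + x)) \<longleftrightarrow> integrable lborel f"
proof -
  show "(LINT x|lborel. f (s + x)) = (LINT x|lborel. f x)"
    by (subst (2) lborel_distr_plus[of s, symmetric]) (simp add: integral_distr)
  show "integrable lborel (\<lambda>x. f (s + x)) \<longleftrightarrow> integrable lborel f"
    by (subst (2) lborel_distr_plus[of s, symmetric]) (simp add: integrable_distr_eq)
qed

text \<open>Inside \<open>E\<close> there is a compact set \<open>K\<close> of positive measure, inside an open set \<open>U\<close> that is larger by less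
  than half the measure of \<open>K\<close>. A translation shorter than the distance of \<open>K\<close> to the complement of \<open>U\<close> moves
  into \<open>U - K\<close> whatever it moves out of \<open>K\<close>, so that the two translations together lose less than all of \<open>K\<close>.\<close>

lemma small_translates_overlap:
  fixes E :: "'a::euclidean_space set"
  assumes E [measurable]: "E \<in> sets borel" and bnd: "bounded E" and pos: "emeasure lborel E \<noteq> 0"
  shows "\<exists>t>0. emeasure lborel {x \<in> E. x + t *\<^sub>R v \<in> E \<and> x - t *\<^sub>R v \<in> E} \<noteq> 0"
proof -
  have fin: "emeasure lborel S < \<infinity>" if "S \<subseteq> E" for S
    using bounded_subset[OF bnd that] by (rule emeasure_bounded_finite)
  have meas_pos: "measure lborel E > 0"
    using pos fin[of E] by (simp add: measure_def enn2real_positive_iff zero_less_iff_neq_zero)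
  obtain G where G: "open G" "- E \<subseteq> G" "emeasure lborel (G - (- E)) < measure lborel E"
    using outer_regular_lborel[OF _ meas_pos, of "- E"] by auto
  define K where "K = - G"
  have KE: "K \<subseteq> E" using G(2) by (auto simp: K_def)
  have K: "compact K"
    unfolding compact_eq_bounded_closed using G(1) bounded_subset[OF bnd KE] by (auto simp: K_def)
  have [measurable]: "K \<in> sets borel" "G \<in> sets borel" using G(1) by (auto simp: K_def)
  have "emeasure lborel K \<noteq> 0"
  proof
    assume "emeasure lborel K = 0"
    moreover have "emeasure lborel E \<le> emeasure lborel K + emeasure lborel (G - (- E))"
      by (rule order_trans[OF emeasure_mono emeasure_subadditive]) (auto simp: K_def)
    ultimately have "emeasure lborel E \<le> emeasure lborel (G - (- E))" by simp
    also have "\<dots> < emeasure lborel E" using G(3) fin[of E] by (simp add: emeasure_eq_ennreal_measure)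
    finally show False by simp
  qed
  then have K_pos: "measure lborel K > 0"
    using fin[OF KE] by (simp add: measure_def enn2real_positive_iff zero_less_iff_neq_zero)
  then obtain U where U: "open U" "K \<subseteq> U" "emeasure lborel (U - K) < ennreal (measure lborel K / 2)"
    using outer_regular_lborel[of K "measure lborel K / 2"] by auto
  obtain d where d: "d > 0" "(\<Union>x\<in>K. ball x d) \<subseteq> U"
    using compact_subset_open_imp_ball_epsilon_subset[OF K U(1,2)] by blast
  have [measurable]: "U \<in> sets borel" using U(1) by simp
  define t where "t = d / (2 * (norm v + 1))"
  have t: "t > 0" using d(1) by (simp add: t_def add_nonneg_pos)
  have "norm (t *\<^sub>R v) < d"
  proof -
    have "norm (t *\<^sub>R v) = d * (norm v / (2 * (norm v + 1)))" using d(1) by (simp add: t_def add_nonneg_pos)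
    also have "\<dots> < d * 1" using d(1) by (intro mult_strict_left_mono) (auto simp: divide_less_eq add_nonneg_pos)
    finally show ?thesis by simp
  qed
  then have shift: "emeasure lborel {x \<in> K. s + x \<notin> K} \<le> emeasure lborel (U - K)" if "s = t *\<^sub>R v \<or> s = - (t *\<^sub>R v)" for s
  proof -
    have "norm s < d" using that \<open>norm (t *\<^sub>R v) < d\<close> by auto
    then have "{x \<in> K. s + x \<notin> K} \<subseteq> (+) s -` (U - K)"
      using d(2) by (force simp: dist_norm)
    then have "emeasure lborel {x \<in> K. s + x \<notin> K} \<le> emeasure lborel ((+) s -` (U - K) \<inter> space lborel)"
      using measurable_sets[of "(+) s" borel borel "U - K"] by (intro emeasure_mono) auto
    also have "\<dots> = emeasure (distr lborel borel ((+) s)) (U - K)"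
      by (subst emeasure_distr) auto
    finally show ?thesis by (simp add: lborel_distr_plus)
  qed
  let ?T = "{x \<in> E. x + t *\<^sub>R v \<in> E \<and> x - t *\<^sub>R v \<in> E}"
  have "emeasure lborel ?T \<noteq> 0"
  proof
    assume T0: "emeasure lborel ?T = 0"
    let ?X = "{x \<in> K. t *\<^sub>R v + x \<notin> K}" and ?Y = "{x \<in> K. - (t *\<^sub>R v) + x \<notin> K}"
    have "K \<subseteq> ?T \<union> (?X \<union> ?Y)" using KE by (auto simp: add.commute)
    then have "emeasure lborel K \<le> emeasure lborel (?T \<union> (?X \<union> ?Y))" by (intro emeasure_mono) auto
    also have "\<dots> \<le> emeasure lborel ?T + (emeasure lborel ?X + emeasure lborel ?Y)"
      by (intro order_trans[OF emeasure_subadditive] add_left_mono emeasure_subadditive) auto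
    also have "\<dots> \<le> emeasure lborel (U - K) + emeasure lborel (U - K)"
      unfolding T0 add_0 by (intro add_mono shift) auto
    also have "\<dots> < ennreal (measure lborel K / 2) + ennreal (measure lborel K / 2)"
      using U(3) by (intro add_strict_mono)
    also have "\<dots> = emeasure lborel K"
      using K_pos fin[OF KE] by (simp add: ennreal_plus[symmetric] emeasure_eq_ennreal_measure del: ennreal_plus)
    finally show False by simp
  qed
  then show ?thesis using t by blast
qed

text \<open>The function is, up to a factor, the second difference with step \<open>t *\<^sub>R v\<close> of the indicator of a set \<open>T\<close>,
  divided by the standard Gaussian density. Its integral against the density with mean \<open>m\<close> is, by
  translation, the integral over \<open>T\<close> of the second difference of \<open>x \<mapsto> exp (m \<bullet> x)\<close>. This is zero if the
  exponential is constant along \<open>v\<close>, and positive otherwise by strict convexity.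
  Choosing \<open>T\<close> so that \<open>T\<close> and its two translates lie in \<open>E\<close> confines the perturbation to \<open>E\<close>.\<close>

lemma convex_perturbation:
  fixes E :: "'a::euclidean_space set"
  assumes E [measurable]: "E \<in> sets borel" and bnd: "bounded E" and pos: "emeasure lborel E \<noteq> 0"
  shows "\<exists>g. g \<in> borel_measurable borel \<and> (\<forall>x. \<bar>g x\<bar> \<le> 1) \<and> (\<forall>x. x \<notin> E \<longrightarrow> g x = 0) \<and>
    (\<forall>m. if m \<bullet> v = 0 then gauss_power g m = 0 else 0 < gauss_power g m)"
proof -
  obtain t where t: "t > 0" and T_pos: "emeasure lborel {x \<in> E. x + t *\<^sub>R v \<in> E \<and> x - t *\<^sub>R v \<in> E} \<noteq> 0"
    using small_translates_overlap[OF assms] by blast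
  define T where "T = {x \<in> E. x + t *\<^sub>R v \<in> E \<and> x - t *\<^sub>R v \<in> E}"
  have [measurable]: "T \<in> sets borel" unfolding T_def by measurable
  obtain N where N: "\<And>x. x \<in> E \<Longrightarrow> norm x \<le> N" using bnd by (auto simp: bounded_iff)
  have T_fin: "emeasure lborel T < \<infinity>"
    using bounded_subset[OF bnd, of T] by (intro emeasure_bounded_finite) (auto simp: T_def)
  \<comment> \<open>A lower bound for the centred density on E; it keeps the quotient in g bounded.\<close>
  define b where "b = exp (- N\<^sup>2 / 2) / sqrt (2 * pi) ^ DIM('a)"
  have b: "b > 0" by (simp add: b_def)
  have b_le: "b \<le> gauss 0 x" if "x \<in> E" for x
  proof -
    have "(norm x)\<^sup>2 \<le> N\<^sup>2" using N[OF that] by (intro power_mono) auto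
    then show ?thesis by (simp add: b_def gauss_def divide_right_mono)
  qed
  let ?I = "\<lambda>s x. indicator T (s + x) :: real"
  let ?s = "t *\<^sub>R v"
  define g where "g x = b / 2 * ((?I (- ?s) x + ?I ?s x - 2 * ?I 0 x) / gauss 0 x)" for x
  define w where "w m x = exp (m \<bullet> x - (norm m)\<^sup>2 / 2)" for m x :: 'a
  have w_meas [measurable]: "w m \<in> borel_measurable borel" for m
    unfolding w_def by measurable
  have int0: "integrable lborel (\<lambda>x. indicator T x * w m x)" for m
  proof -
    have "integrable lborel (\<lambda>x. indicator T x *\<^sub>R w m x)"
    proof (rule integrableI_bounded_set_indicator[where B = "exp (norm m * N)"])
      show "AE x in lborel. x \<in> T \<longrightarrow> norm (w m x) \<le> exp (norm m * N)"
      proof (intro AE_I2 impI)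
        fix x assume "x \<in> T"
        then have "m \<bullet> x \<le> norm m * N"
          using N[of x] by (intro order_trans[OF norm_cauchy_schwarz] mult_left_mono) (auto simp: T_def)
        then have "m \<bullet> x - (norm m)\<^sup>2 / 2 \<le> norm m * N"
          using zero_le_power2[of "norm m"] by linarith
        then show "norm (w m x) \<le> exp (norm m * N)" by (simp add: w_def)
      qed
    qed (use T_fin in auto)
    then show ?thesis by simp
  qed
  define J where "J m = (LINT x|lborel. indicator T x * w m x)" for m
  have J_pos: "J m > 0" for m
  proof -
    have nn: "AE x in lborel. 0 \<le> indicator T x * w m x" by (simp add: w_def)
    have "J m \<noteq> 0"
    proof
      assume "J m = 0"
      then have "AE x in lborel. indicator T x * w m x = 0"
        using integral_nonneg_eq_0_iff_AE[OF int0 nn] by (simp add: J_def)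
      then have "AE x in lborel. x \<notin> T"
        by eventually_elim (auto simp: w_def indicator_def)
      then have "emeasure lborel T = 0" by (subst (asm) AE_iff_null) (auto simp: null_sets_def)
      then show False using T_pos by (simp add: T_def)
    qed
    moreover have "0 \<le> J m" unfolding J_def by (rule integral_nonneg_AE[OF nn])
    ultimately show ?thesis by simp
  qed
  have trans: "integrable lborel (\<lambda>x. ?I s x * w m x)"
    "(LINT x|lborel. ?I s x * w m x) = exp (- (m \<bullet> s)) * J m" for s m
  proof -
    have eq: "(\<lambda>x. ?I s x * w m x) = (\<lambda>x. exp (- (m \<bullet> s)) * (?I s x * w m (s + x)))"
      by (simp add: fun_eq_iff w_def exp_add[symmetric] inner_add_right diff_add_eq)
    show "integrable lborel (\<lambda>x. ?I s x * w m x)"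
      "(LINT x|lborel. ?I s x * w m x) = exp (- (m \<bullet> s)) * J m"
      unfolding eq using lborel_integral_translate[of "\<lambda>x. indicator T x * w m x" s] int0[of m]
      by (simp_all only: J_def integral_mult_right_zero integrable_mult_right borel_measurable_times
          w_meas borel_measurable_indicator \<open>T \<in> sets borel\<close>)
  qed
  have power_g: "gauss_power g m = b / 2 * ((exp (m \<bullet> ?s / 2) - exp (- (m \<bullet> ?s) / 2))\<^sup>2 * J m)" for m
  proof -
    have "gauss_power g m = (LINT x|lborel. b / 2 * (?I (- ?s) x * w m x + ?I ?s x * w m x - 2 * (?I 0 x * w m x)))"
      unfolding gauss_power_def
    proof (rule Bochner_Integration.integral_cong)
      fix x
      show "g x * gauss m x = b / 2 * (?I (- ?s) x * w m x + ?I ?s x * w m x - 2 * (?I 0 x * w m x))"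
        using gauss_pos[of 0 x] unfolding g_def gauss_tilt[of m x] w_def by (simp add: field_simps)
    qed simp
    also have "\<dots> = b / 2 * ((LINT x|lborel. ?I (- ?s) x * w m x) + (LINT x|lborel. ?I ?s x * w m x)
        - 2 * (LINT x|lborel. ?I 0 x * w m x))"
      using trans(1)[of "- ?s" m] trans(1)[of ?s m] trans(1)[of 0 m]
      by (simp only: integral_mult_right_zero Bochner_Integration.integral_diff Bochner_Integration.integral_add
          Bochner_Integration.integrable_add integrable_mult_right)
    also have "\<dots> = b / 2 * ((exp (m \<bullet> ?s) + exp (- (m \<bullet> ?s)) - 2) * J m)"
      unfolding trans(2) by (simp add: algebra_simps)
    also have "exp (m \<bullet> ?s) + exp (- (m \<bullet> ?s)) - 2 = (exp (m \<bullet> ?s / 2) - exp (- (m \<bullet> ?s) / 2))\<^sup>2"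
      by (simp add: power2_diff exp_double[symmetric] exp_add[symmetric])
    finally show ?thesis .
  qed
  have "\<bar>g x\<bar> \<le> 1 \<and> (x \<notin> E \<longrightarrow> g x = 0)" for x
  proof (cases "x \<in> E")
    case True
    have "\<bar>?I (- ?s) x + ?I ?s x - 2 * ?I 0 x\<bar> \<le> 2" by (auto simp: indicator_def)
    then have "\<bar>g x\<bar> \<le> b / 2 * (2 / gauss 0 x)"
      unfolding g_def abs_mult abs_divide using b gauss_pos[of 0 x]
      by (intro mult_mono divide_mono) auto
    also have "\<dots> \<le> 1" using b_le[OF True] gauss_pos[of 0 x] by (simp add: field_simps)
    finally show ?thesis using True by simp
  next
    case False
    then have "- ?s + x \<notin> T" "?s + x \<notin> T" "0 + x \<notin> T" by (auto simp: T_def add.commute)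
    then show ?thesis by (simp add: g_def)
  qed
  moreover have "g \<in> borel_measurable borel" unfolding g_def by measurable
  moreover have "if m \<bullet> v = 0 then gauss_power g m = 0 else 0 < gauss_power g m" for m
    using J_pos[of m] b t by (simp add: power_g)
  ultimately show ?thesis by blast
qed

context shift_testing
begin

text \<open>Where two optimal tests differ, their midpoint, which is optimal too, takes values strictly between 0 and
  1. It can be perturbed there as in \<open>convex_perturbation\<close>: the null powers do not change, since the null
  means are orthogonal to \<open>v\<close>, while the power at \<open>\<theta>1\<close> and hence, by full support, the average power
  increases.\<close>

lemma optimal_unique:
  assumes null: "\<And>\<theta>. \<theta> \<in> A \<Longrightarrow> m0 \<theta> \<bullet> v = 0" and alt: "\<theta>1 \<in> A" "m1 \<theta>1 \<bullet> v \<noteq> 0"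
    and \<phi>: "optimal \<phi>" and \<psi>: "optimal \<psi>"
  shows "AE x in lborel. \<phi> x = \<psi> x"
proof (rule ccontr)
  assume neq: "\<not> ?thesis"
  have ub: "unbiased \<phi>" "unbiased \<psi>" and eq: "avg_power \<phi> = avg_power \<psi>"
    using \<phi> \<psi> by (auto simp: optimal_def intro: antisym)
  have t: "is_test \<phi>" "is_test \<psi>" using ub by (auto simp: unbiased_def)
  have [measurable]: "\<phi> \<in> borel_measurable borel" "\<psi> \<in> borel_measurable borel" using t[THEN is_testD(1)] .
  define E where "E n = {x. norm x \<le> real n \<and> 1 / real (Suc n) \<le> \<bar>\<phi> x - \<psi> x\<bar>}" for n
  have E_meas [measurable]: "E n \<in> sets borel" for n unfolding E_def by measurable
  have "\<exists>n. emeasure lborel (E n) \<noteq> 0"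
  proof (rule ccontr)
    assume "\<not> ?thesis"
    then have "AE x in lborel. \<forall>n. x \<notin> E n"
      unfolding AE_all_countable by (auto intro!: AE_not_in simp: null_sets_def)
    then have "AE x in lborel. \<phi> x = \<psi> x"
    proof eventually_elim
      case (elim x)
      show ?case
      proof (rule ccontr)
        assume "\<phi> x \<noteq> \<psi> x"
        then have d: "\<bar>\<phi> x - \<psi> x\<bar> > 0" by simp
        obtain n where n: "max (norm x) (1 / \<bar>\<phi> x - \<psi> x\<bar>) \<le> real n" using real_arch_simple by blast
        then have "1 / \<bar>\<phi> x - \<psi> x\<bar> \<le> real (Suc n)" by simp
        then have "1 / real (Suc n) \<le> \<bar>\<phi> x - \<psi> x\<bar>" using d by (simp add: field_simps)
        then have "x \<in> E n" using n by (simp add: E_def)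
        then show False using elim by blast
      qed
    qed
    then show False using neq by blast
  qed
  then obtain n where n: "emeasure lborel (E n) \<noteq> 0" by blast
  have "bounded (E n)" by (auto simp: bounded_iff E_def)
  then obtain g where g: "g \<in> borel_measurable borel" "\<And>x. \<bar>g x\<bar> \<le> 1" "\<And>x. x \<notin> E n \<Longrightarrow> g x = 0"
      and gp: "\<And>m. if m \<bullet> v = 0 then gauss_power g m = 0 else 0 < gauss_power g m"
    using convex_perturbation[OF E_meas _ n, of v] by blast
  have g_null: "gauss_power g (m0 \<theta>) = 0" if "\<theta> \<in> A" for \<theta> using gp[of "m0 \<theta>"] null[OF that] by simp
  have g_nonneg: "0 \<le> gauss_power g m" for m using gp[of m] by (simp split: if_splits)
  \<comment> \<open>On E n the midpoint stays at least this far from 0 and 1.\<close>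
  define \<kappa> where "\<kappa> = 1 / (2 * real (Suc n))"
  have \<kappa>: "\<kappa> > 0" by (simp add: \<kappa>_def)
  let ?w = "\<lambda>x. (\<phi> x + \<psi> x) / 2"
  have tw: "is_test ?w" by (rule is_test_midpoint[OF t])
  define \<xi> where "\<xi> x = 1 * ?w x + \<kappa> * g x" for x
  have \<xi>: "is_test \<xi>"
    unfolding is_test_def
  proof (intro conjI allI)
    show "\<xi> \<in> borel_measurable borel" unfolding \<xi>_def using g(1) by measurable
    fix x
    have r: "0 \<le> \<phi> x" "\<phi> x \<le> 1" "0 \<le> \<psi> x" "\<psi> x \<le> 1" using is_testD(3,4)[OF t(1)] is_testD(3,4)[OF t(2)] by blast+
    have "0 \<le> \<xi> x \<and> \<xi> x \<le> 1"
    proof (cases "x \<in> E n")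
      case True
      moreover have "2 * \<kappa> = 1 / real (Suc n)" by (simp add: \<kappa>_def field_simps)
      ultimately have "2 * \<kappa> \<le> \<bar>\<phi> x - \<psi> x\<bar>" by (simp only: E_def mem_Collect_eq)
      then have "\<kappa> \<le> ?w x" "?w x \<le> 1 - \<kappa>" using r by (simp_all add: abs_if split: if_splits)
      moreover have "\<bar>\<kappa> * g x\<bar> \<le> \<kappa>" using \<kappa> g(2)[of x] by (simp add: abs_mult mult_left_le)
      ultimately show ?thesis unfolding \<xi>_def by linarith
    next
      case False
      then show ?thesis using g(3) r by (simp add: \<xi>_def)
    qed
    then show "0 \<le> \<xi> x" "\<xi> x \<le> 1" by auto
  qed
  have p\<xi>: "gauss_power \<xi> m = gauss_power ?w m + \<kappa> * gauss_power g m" for m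
    unfolding \<xi>_def by (subst gauss_power_add[OF is_testD(1,2)[OF tw] g(1,2)]) simp
  have ubw: "unbiased ?w" by (rule unbiased_midpoint[OF ub])
  have "unbiased \<xi>"
    unfolding unbiased_def
  proof (intro conjI ballI \<xi>)
    fix \<theta> assume \<theta>: "\<theta> \<in> A"
    have "gauss_power ?w (m0 \<theta>) \<le> \<alpha>" "\<alpha> \<le> gauss_power ?w (m1 \<theta>)" using ubw \<theta> by (auto simp: unbiased_def)
    then show "gauss_power \<xi> (m0 \<theta>) \<le> \<alpha>" "\<alpha> \<le> gauss_power \<xi> (m1 \<theta>)"
      using g_null[OF \<theta>] mult_nonneg_nonneg[OF less_imp_le[OF \<kappa>] g_nonneg[of "m1 \<theta>"]] by (auto simp: p\<xi>)
  qed
  then have "avg_power \<xi> \<le> avg_power \<phi>" using \<phi> by (simp add: optimal_def)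
  also have "avg_power \<phi> = avg_power ?w" using avg_power_midpoint[OF t] eq by simp
  finally have le: "avg_power \<xi> \<le> avg_power ?w" .
  have cont: "continuous_on UNIV (\<lambda>\<theta>. gauss_power g (m1 \<theta>))"
    by (rule gauss_power_continuous[OF g(1,2) m1])
  have bnd: "\<bar>gauss_power g (m1 \<theta>)\<bar> \<le> 1" for \<theta> by (rule gauss_power_abs_le[OF g(1,2)])
  have "integrable L (\<lambda>\<theta>. gauss_power g (m1 \<theta>))"
    using bnd cont by (intro integrable_bounded_L borel_measurable_continuous_onI)
  then have "avg_power \<xi> = avg_power ?w + \<kappa> * (LINT \<theta>|L. gauss_power g (m1 \<theta>))"
    unfolding avg_power_def p\<xi> using integrable_power(2)[OF tw] by simp
  then have "(LINT \<theta>|L. gauss_power g (m1 \<theta>)) \<le> 0" using le \<kappa> by (simp add: mult_le_0_iff)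
  then have "gauss_power g (m1 \<theta>1) = 0"
    using full_support_integral_zero[OF L sets_L AE_A supp cont bnd _ _ alt(1)] g_nonneg by blast
  then show False using gp[of "m1 \<theta>1"] alt(2) by simp
qed

end

section \<open>The model\<close>

definition model_mean ::
  "real^(2 \<times> 'k)^(2 \<times> 'k) \<Rightarrow> real \<Rightarrow> real \<times> (real^'k) \<Rightarrow> (real^'k) \<times> (real^'k)" where
  "model_mean \<Sigma> \<beta>0 \<theta> =
    ((fst \<theta> - \<beta>0) *\<^sub>R (C_mat \<Sigma> \<beta>0 *v snd \<theta>), D_mat \<Sigma> \<beta>0 (fst \<theta>) *v snd \<theta>)"

lemma joint_density_eq_gauss: "joint_density \<Sigma> \<beta>0 \<beta> \<mu> x = gauss (model_mean \<Sigma> \<beta>0 (\<beta>, \<mu>)) x"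
  by (cases x) (simp add: joint_density_def model_mean_def gauss_Pair std_normal_vec_density_eq_gauss)

lemma power_fun_eq_gauss_power: "power_fun \<Sigma> \<beta>0 \<phi> \<beta> \<mu> = gauss_power \<phi> (model_mean \<Sigma> \<beta>0 (\<beta>, \<mu>))"
  by (simp add: power_fun_def gauss_power_def joint_density_eq_gauss)

lemma continuous_on_matrix_vector_mult [continuous_intros]:
  fixes M :: "real^'n^'m"
  shows "continuous_on S f \<Longrightarrow> continuous_on S (\<lambda>x. M *v f x)"
  by (rule continuous_on_compose2[OF matrix_vector_mult_linear_continuous_on[of UNIV M]]) auto

lemma continuous_on_model_mean [continuous_intros]:
  assumes "continuous_on S f"
  shows "continuous_on S (\<lambda>x. model_mean (\<Sigma> :: real^(2 \<times> 'k::finite)^(2 \<times> 'k)) \<beta>0 (f x))"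
proof -
  have f: "continuous_on S (\<lambda>x. fst (f x))" "continuous_on S (\<lambda>x. snd (f x))"
    using continuous_on_fst[OF assms] continuous_on_snd[OF assms] .
  have kron_I_mult: "kron_I v *v y = (\<chi> p. v $ fst p * y $ snd p)" for v and y :: "real^'k"
    by (simp add: vec_eq_iff kron_I_mult_component)
  have a: "continuous_on S (\<lambda>x. a_vec (fst (f x)) $ i)" for i
    using f(1) exhaust_2[of i] by (auto simp: a_vec_def vector_2)
  have "continuous_on S (\<lambda>x. kron_I (a_vec (fst (f x))) *v snd (f x))"
    unfolding kron_I_mult by (intro continuous_on_vec_lambda continuous_on_mult continuous_on_component[OF f(2)] a)
  then show ?thesis
    unfolding model_mean_def D_mat_def matrix_vector_mul_assoc[symmetric]
    by (intro continuous_intros f)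
qed

lemma mix_density_eq: "mix_density \<Sigma> \<beta>0 \<Lambda> x = (LINT \<theta>|\<Lambda>. gauss (model_mean \<Sigma> \<beta>0 \<theta>) x)"
  by (simp add: mix_density_def joint_density_eq_gauss case_prod_beta')

lemma measurable_gauss_model_mean:
  "(\<lambda>\<theta>. gauss (model_mean \<Sigma> \<beta>0 \<theta>) x) \<in> borel_measurable borel"
  "(\<lambda>\<mu>. gauss (model_mean \<Sigma> \<beta>0 (\<beta>, \<mu>)) x) \<in> borel_measurable borel"
  by (intro borel_measurable_continuous_onI continuous_intros)+

lemma finite_borel_measure_on_return:
  fixes x :: "'a::t2_space"
  assumes "x \<in> S"
  shows "finite_borel_measure_on S (return borel x)"
  unfolding finite_borel_measure_on_def
proof (intro conjI)
  show "finite_measure (return borel x)" by (intro prob_space.finite_measure prob_space_return) simp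
  have "AE y in return borel x. y = x" by (simp add: AE_return)
  then show "AE y in return borel x. y \<in> S" by eventually_elim (use assms in simp)
qed simp

text \<open>The rejection probabilities at \<open>(\<beta>, \<mu>)\<close> are at least \<open>\<alpha>\<close> for \<open>\<beta> \<noteq> \<beta>0\<close>; continuity carries this over to the
  null.\<close>

lemma power_null_eq_if_limit_point:
  assumes \<phi>: "unbiased_test \<Sigma> \<beta>0 \<alpha> B P \<phi>" and lp: "\<beta>0 islimpt B" and \<mu>: "\<mu> \<in> P"
  shows "gauss_power \<phi> (model_mean \<Sigma> \<beta>0 (\<beta>0, \<mu>)) = \<alpha>"
proof (rule antisym)
  have t: "is_test \<phi>" using \<phi> by (simp add: unbiased_test_def)
  show "gauss_power \<phi> (model_mean \<Sigma> \<beta>0 (\<beta>0, \<mu>)) \<le> \<alpha>"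
    using \<phi> \<mu> by (simp add: unbiased_test_def power_fun_eq_gauss_power)
  obtain b where b: "\<And>n::nat. b n \<in> B - {\<beta>0}" "b \<longlonglongrightarrow> \<beta>0"
    using lp unfolding islimpt_sequential by blast
  have "continuous_on UNIV (\<lambda>\<beta>. gauss_power \<phi> (model_mean \<Sigma> \<beta>0 (\<beta>, \<mu>)))"
    by (intro gauss_power_continuous[OF is_testD(1,2)[OF t]] continuous_intros)
  then have "(\<lambda>n. gauss_power \<phi> (model_mean \<Sigma> \<beta>0 (b n, \<mu>))) \<longlonglongrightarrow> gauss_power \<phi> (model_mean \<Sigma> \<beta>0 (\<beta>0, \<mu>))"
    using b(2) by (rule continuous_on_tendsto_compose) auto
  then show "\<alpha> \<le> gauss_power \<phi> (model_mean \<Sigma> \<beta>0 (\<beta>0, \<mu>))"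
    using \<phi> \<mu> b(1) by (intro LIMSEQ_le_const) (auto simp: unbiased_test_def power_fun_eq_gauss_power)
qed

text \<open>For \<open>\<mu> = 0\<close> the distribution does not depend on \<open>\<beta>\<close>, so point masses give equal mixtures, which leave the
  test unrestricted.\<close>

lemma point_mass_null_bayes:
  assumes "is_test \<phi>" "\<beta>1 \<in> B" "\<beta>1 \<noteq> \<beta>0" "0 \<in> P"
  shows "bayes_test \<Sigma> \<beta>0 B P \<phi>"
  unfolding bayes_test_def
proof (intro conjI exI)
  let ?\<Lambda>1 = "return borel (\<beta>1, 0) :: (real \<times> (real^'a)) measure"
  let ?\<Lambda>0 = "return borel 0 :: (real^'a) measure"
  show "finite_borel_measure_on ((B - {\<beta>0}) \<times> P) ?\<Lambda>1" "finite_borel_measure_on P ?\<Lambda>0"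
    using assms by (auto intro!: finite_borel_measure_on_return)
  show "emeasure ?\<Lambda>1 UNIV > 0" "emeasure ?\<Lambda>0 UNIV > 0" by (simp_all add: emeasure_return)
  have "mix_density \<Sigma> \<beta>0 ?\<Lambda>1 x = (LINT \<mu>|?\<Lambda>0. joint_density \<Sigma> \<beta>0 \<beta>0 \<mu> x)" for x
    using integral_return[OF _ measurable_gauss_model_mean(1)[of \<Sigma> \<beta>0 x], of "(\<beta>1, 0)"]
      integral_return[OF _ measurable_gauss_model_mean(2)[of \<Sigma> \<beta>0 \<beta>0 x], of 0]
    by (simp add: mix_density_eq joint_density_eq_gauss model_mean_def)
  then show "\<forall>x. (mix_density \<Sigma> \<beta>0 ?\<Lambda>1 x > (LINT \<mu>|?\<Lambda>0. joint_density \<Sigma> \<beta>0 \<beta>0 \<mu> x) \<longrightarrow> \<phi> x = 1) \<and>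
    (mix_density \<Sigma> \<beta>0 ?\<Lambda>1 x < (LINT \<mu>|?\<Lambda>0. joint_density \<Sigma> \<beta>0 \<beta>0 \<mu> x) \<longrightarrow> \<phi> x = 0)" by simp
qed fact

lemma finite_borel_measure_on_density:
  assumes "finite_measure M" and sets: "sets M = sets borel" and "AE x in M. x \<in> S"
    and w: "w \<in> borel_measurable borel" "\<And>x. 0 \<le> w x" "\<And>x. w x \<le> c"
  shows "finite_borel_measure_on S (density M (\<lambda>x. ennreal (w x)))"
    and "emeasure (density M (\<lambda>x. ennreal (w x))) UNIV = ennreal (LINT x|M. w x)"
proof -
  interpret finite_measure M by fact
  have wM: "w \<in> borel_measurable M" using w(1) by (simp add: measurable_cong_sets[OF sets refl])
  have int: "integrable M w" by (rule integrable_const_bound[of _ c]) (use w wM in auto)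
  have sp: "space M = UNIV" using sets_eq_imp_space_eq[OF sets] by simp
  have "emeasure (density M (\<lambda>x. ennreal (w x))) UNIV = (\<integral>\<^sup>+x. ennreal (w x) \<partial>M)"
    using wM sp sets.top[of M] by (simp add: emeasure_density)
  also have "\<dots> = ennreal (LINT x|M. w x)" using int w(2) by (intro nn_integral_eq_integral) auto
  finally show em: "emeasure (density M (\<lambda>x. ennreal (w x))) UNIV = ennreal (LINT x|M. w x)" .
  show "finite_borel_measure_on S (density M (\<lambda>x. ennreal (w x)))"
    unfolding finite_borel_measure_on_def
  proof (intro conjI)
    show "sets (density M (\<lambda>x. ennreal (w x))) = sets borel" using sets by simp
    show "finite_measure (density M (\<lambda>x. ennreal (w x)))"
      by (rule finite_measureI) (use em sp in simp)
    show "AE x in density M (\<lambda>x. ennreal (w x)). x \<in> S"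
      using wM assms(3) by (subst AE_density) auto
  qed
qed

text \<open>The two measures of a Bayes test are given here by densities with respect to one measure \<open>L\<close> on the
  alternative; the one on the null is the image of the second under projection to \<open>\<mu>\<close>.\<close>

lemma weighted_mixtures_bayes:
  fixes L :: "(real \<times> (real^'k)) measure"
  assumes L: "finite_measure L" and sets: "sets L = sets borel" and AE: "AE \<theta> in L. \<theta> \<in> (B - {\<beta>0}) \<times> P"
    and P: "P \<in> sets borel" and \<phi>: "is_test \<phi>"
    and w1: "w1 \<in> borel_measurable borel" "\<And>\<theta>. 0 \<le> w1 \<theta>" "\<And>\<theta>. w1 \<theta> \<le> c" "0 < (LINT \<theta>|L. w1 \<theta>)"
    and w0: "w0 \<in> borel_measurable borel" "\<And>\<theta>. 0 \<le> w0 \<theta>" "\<And>\<theta>. w0 \<theta> \<le> c" "0 < (LINT \<theta>|L. w0 \<theta>)"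
    and reject: "\<And>x. (LINT \<theta>|L. w0 \<theta> * gauss (model_mean \<Sigma> \<beta>0 (\<beta>0, snd \<theta>)) x)
      < (LINT \<theta>|L. w1 \<theta> * gauss (model_mean \<Sigma> \<beta>0 \<theta>) x) \<Longrightarrow> \<phi> x = 1"
    and accept: "\<And>x. (LINT \<theta>|L. w1 \<theta> * gauss (model_mean \<Sigma> \<beta>0 \<theta>) x)
      < (LINT \<theta>|L. w0 \<theta> * gauss (model_mean \<Sigma> \<beta>0 (\<beta>0, snd \<theta>)) x) \<Longrightarrow> \<phi> x = 0"
  shows "bayes_test \<Sigma> \<beta>0 B P \<phi>"
  unfolding bayes_test_def
proof (intro conjI exI \<phi>)
  let ?\<Lambda>1 = "density L (\<lambda>\<theta>. ennreal (w1 \<theta>))" and ?D = "density L (\<lambda>\<theta>. ennreal (w0 \<theta>))"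
  let ?\<Lambda>0 = "distr ?D borel snd"
  have snd: "snd \<in> measurable ?D borel"
    using borel_measurable_continuous_onI[OF continuous_on_snd[OF continuous_on_id]]
    by (simp add: measurable_cong_sets[OF sets refl])
  have AE_P: "AE \<theta> in L. \<theta> \<in> UNIV \<times> P" using AE by eventually_elim auto
  note d1 = finite_borel_measure_on_density[OF L sets AE w1(1,2,3)]
  note d0 = finite_borel_measure_on_density[OF L sets AE_P w0(1,2,3)]
  show "finite_borel_measure_on ((B - {\<beta>0}) \<times> P) ?\<Lambda>1" "emeasure ?\<Lambda>1 UNIV > 0"
    using d1 w1(4) by auto
  have "space ?D = UNIV" using sets_eq_imp_space_eq[OF sets] by simp
  then show "emeasure ?\<Lambda>0 UNIV > 0"
    using d0(2) w0(4) by (simp add: emeasure_distr[OF snd])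
  show "finite_borel_measure_on P ?\<Lambda>0"
    unfolding finite_borel_measure_on_def
  proof (intro conjI)
    show "finite_measure ?\<Lambda>0"
      using d0(1) by (intro finite_measure.finite_measure_distr snd) (simp add: finite_borel_measure_on_def)
    show "AE \<mu> in ?\<Lambda>0. \<mu> \<in> P"
      using d0(1) P by (subst AE_distr_iff[OF snd]) (auto simp: finite_borel_measure_on_def mem_Times_iff)
  qed simp
  have mix1: "mix_density \<Sigma> \<beta>0 ?\<Lambda>1 x = (LINT \<theta>|L. w1 \<theta> * gauss (model_mean \<Sigma> \<beta>0 \<theta>) x)" for x
    unfolding mix_density_eq
    using integral_density[of "\<lambda>\<theta>. gauss (model_mean \<Sigma> \<beta>0 \<theta>) x" L w1] measurable_gauss_model_mean(1)[of \<Sigma> \<beta>0 x] w1(1,2)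
    by (simp add: measurable_cong_sets[OF sets refl])
  have m0: "(\<lambda>\<theta>. gauss (model_mean \<Sigma> \<beta>0 (\<beta>0, snd \<theta>)) x) \<in> borel_measurable borel" for x
    by (intro borel_measurable_continuous_onI continuous_intros)
  have mix0: "(LINT \<mu>|?\<Lambda>0. joint_density \<Sigma> \<beta>0 \<beta>0 \<mu> x)
      = (LINT \<theta>|L. w0 \<theta> * gauss (model_mean \<Sigma> \<beta>0 (\<beta>0, snd \<theta>)) x)" for x
    unfolding joint_density_eq_gauss integral_distr[OF snd measurable_gauss_model_mean(2)]
    using integral_density[of "\<lambda>\<theta>. gauss (model_mean \<Sigma> \<beta>0 (\<beta>0, snd \<theta>)) x" L w0] m0[of x] w0(1,2)
    by (simp add: measurable_cong_sets[OF sets refl])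
  show "\<forall>x. (mix_density \<Sigma> \<beta>0 ?\<Lambda>1 x > (LINT \<mu>|?\<Lambda>0. joint_density \<Sigma> \<beta>0 \<beta>0 \<mu> x) \<longrightarrow> \<phi> x = 1) \<and>
    (mix_density \<Sigma> \<beta>0 ?\<Lambda>1 x < (LINT \<mu>|?\<Lambda>0. joint_density \<Sigma> \<beta>0 \<beta>0 \<mu> x) \<longrightarrow> \<phi> x = 0)"
    unfolding mix1 mix0 using reject accept by blast
qed

lemma shift_testing_alternative_weight:
  fixes \<Lambda> :: "(real \<times> (real^'k)) measure"
  assumes \<alpha>: "0 < \<alpha>" "\<alpha> < 1"
    and B: "\<beta>0 \<in> B" "B \<noteq> {\<beta>0}" and P: "P \<noteq> {}"
    and \<Lambda>: "finite_borel_measure_on (B \<times> P) \<Lambda>" and supp: "full_support_on ((B - {\<beta>0}) \<times> P) \<Lambda>"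
  shows "shift_testing (density \<Lambda> (indicator {\<theta>. fst \<theta> \<noteq> \<beta>0})) ((B - {\<beta>0}) \<times> P)
    (\<lambda>\<theta>. model_mean \<Sigma> \<beta>0 (\<beta>0, snd \<theta>)) (model_mean \<Sigma> \<beta>0) \<alpha>"
proof (rule shift_testing.intro)
  let ?U = "{\<theta> :: real \<times> (real^'k). fst \<theta> \<noteq> \<beta>0}"
  let ?L = "density \<Lambda> (indicator ?U)"
  have sets: "sets \<Lambda> = sets borel" and "finite_measure \<Lambda>" and AE: "AE \<theta> in \<Lambda>. \<theta> \<in> B \<times> P"
    using \<Lambda> by (auto simp: finite_borel_measure_on_def)
  interpret finite_measure \<Lambda> by fact
  have oU: "open ?U" by (intro open_Collect_neq continuous_intros)
  then have U: "?U \<in> sets \<Lambda>" by (simp add: sets)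
  have em: "emeasure ?L X = emeasure \<Lambda> (?U \<inter> X)" if "X \<in> sets \<Lambda>" for X
    by (rule emeasure_restricted[OF U that])
  show "finite_measure ?L"
    by (rule finite_measureI) (use em[of "space \<Lambda>"] in \<open>auto simp: emeasure_eq_measure\<close>)
  show "sets ?L = sets borel" using sets by simp
  show "(B - {\<beta>0}) \<times> P \<noteq> {}" using B P by auto
  have "AE \<theta> in \<Lambda>. (0 :: ennreal) < indicator ?U \<theta> \<longrightarrow> \<theta> \<in> (B - {\<beta>0}) \<times> P"
    using AE by eventually_elim (auto simp: indicator_def)
  then show "AE \<theta> in ?L. \<theta> \<in> (B - {\<beta>0}) \<times> P"
    using U by (subst AE_density) auto
  show "full_support_on ((B - {\<beta>0}) \<times> P) ?L"
    unfolding full_support_on_def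
  proof (intro allI impI, elim conjE)
    fix X :: "(real \<times> (real^'k)) set" assume X: "open X" "X \<inter> (B - {\<beta>0}) \<times> P \<noteq> {}"
    have "open (?U \<inter> X)" using oU X(1) by (rule open_Int)
    moreover obtain \<theta> where "\<theta> \<in> X" "\<theta> \<in> (B - {\<beta>0}) \<times> P" using X(2) by blast
    then have "\<theta> \<in> (?U \<inter> X) \<inter> (B - {\<beta>0}) \<times> P" by auto
    ultimately have "emeasure \<Lambda> (?U \<inter> X) > 0" using supp unfolding full_support_on_def by blast
    then show "emeasure ?L X > 0" using em[of X] X(1) by (simp add: sets)
  qed
  show "continuous_on UNIV (\<lambda>\<theta>. model_mean \<Sigma> \<beta>0 (\<beta>0, snd \<theta>))"
    by (intro continuous_on_model_mean continuous_on_Pair continuous_on_const continuous_on_snd continuous_on_id)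
  show "continuous_on UNIV (model_mean \<Sigma> \<beta>0)"
    using continuous_on_model_mean[OF continuous_on_id] by simp
qed (use \<alpha> in auto)

section \<open>Bayes limits and admissibility\<close>

theorem theorem3:
  fixes \<beta>0 \<alpha> :: real and \<Sigma> :: "real^(2 \<times> 'k::finite)^(2 \<times> 'k)"
    and B :: "real set" and P :: "(real^'k) set" and \<Lambda> :: "(real \<times> (real^'k)) measure"
  assumes "0 < \<alpha>" and "\<alpha> < 1"
    and "pos_def \<Sigma>"
    and "compact B" and "compact P"
    and "\<beta>0 \<in> B" and "B \<noteq> {\<beta>0}" and "P \<noteq> {}"
    and "finite_borel_measure_on (B \<times> P) \<Lambda>"
    and "(\<beta>0 islimpt B \<and> full_support_on (B \<times> P) \<Lambda>) \<or>
         (emeasure \<Lambda> ({\<beta>0} \<times> P) = 0 \<and> full_support_on ((B - {\<beta>0}) \<times> P) \<Lambda>)"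
  shows "(\<exists>\<phi>. WAP_unbiased_test \<Sigma> \<beta>0 \<alpha> B P \<Lambda> \<phi>) \<and>
    (\<forall>\<phi>. WAP_unbiased_test \<Sigma> \<beta>0 \<alpha> B P \<Lambda> \<phi> \<longrightarrow>
      (\<exists>\<phi>s. (\<forall>m. bayes_test \<Sigma> \<beta>0 B P (\<phi>s m)) \<and> weak_star_converges \<phi>s \<phi>) \<and>
      admissible_test \<Sigma> \<beta>0 B P \<phi>)"
proof -
  define A where "A = (B - {\<beta>0}) \<times> P"
  define U where "U = {\<theta> :: real \<times> (real^'k). fst \<theta> \<noteq> \<beta>0}"
  define L where "L = density \<Lambda> (indicator U)"
  define m1 where "m1 = model_mean \<Sigma> \<beta>0"
  define m0 where "m0 \<theta> = m1 (\<beta>0, snd \<theta>)" for \<theta> :: "real \<times> (real^'k)"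
  have sets: "sets \<Lambda> = sets borel" and fin: "finite_measure \<Lambda>" and AE: "AE \<theta> in \<Lambda>. \<theta> \<in> B \<times> P"
    using assms(9) by (auto simp: finite_borel_measure_on_def)
  interpret \<Lambda>: finite_measure \<Lambda> by fact
  have U: "U \<in> sets \<Lambda>" unfolding U_def sets by (intro borel_open open_Collect_neq continuous_intros)
  have "full_support_on A \<Lambda>" using assms(10) unfolding A_def full_support_on_def by blast
  then have "shift_testing L A m0 m1 \<alpha>"
    using shift_testing_alternative_weight[OF assms(1,2,6,7,8,9), of \<Sigma>]
    unfolding A_def L_def U_def m0_def m1_def by simp
  then interpret S: shift_testing L A m0 m1 \<alpha> .
  obtain \<beta>1 where \<beta>1: "\<beta>1 \<in> B" "\<beta>1 \<noteq> \<beta>0" using assms(6,7) by blast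
  have pow: "power_fun \<Sigma> \<beta>0 \<phi> \<beta> \<mu> = gauss_power \<phi> (m1 (\<beta>, \<mu>))" for \<phi> \<beta> \<mu>
    by (simp add: power_fun_eq_gauss_power m1_def)
  have unb: "unbiased_test \<Sigma> \<beta>0 \<alpha> B P \<phi> \<longleftrightarrow> S.unbiased \<phi>" for \<phi>
    unfolding unbiased_test_def S.unbiased_def pow using \<beta>1 by (auto simp: A_def m0_def)
  \<comment> \<open>The contribution of the null to the weighted average power, the same for all unbiased tests.\<close>
  define d where "d = (LINT \<theta>|\<Lambda>. indicator (- U) \<theta> * \<alpha>)"
  have wap: "weighted_average_power \<Sigma> \<beta>0 \<Lambda> \<phi> = S.avg_power \<phi> + d" if u: "S.unbiased \<phi>" for \<phi>
  proof -
    have t: "is_test \<phi>" using u by (simp add: S.unbiased_def)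
    let ?p = "\<lambda>\<theta>. gauss_power \<phi> (m1 \<theta>)"
    have p: "?p \<in> borel_measurable \<Lambda>"
      using S.measurable_power(2)[OF t] by (simp add: measurable_cong_sets[OF sets refl])
    have int: "integrable \<Lambda> (\<lambda>\<theta>. indicator X \<theta> * ?p \<theta>)" if "X \<in> sets \<Lambda>" for X
      using p that gauss_power_test(3)[OF t]
      by (intro \<Lambda>.integrable_const_bound[of _ 1]) (auto simp: indicator_def)
    have "weighted_average_power \<Sigma> \<beta>0 \<Lambda> \<phi> = (LINT \<theta>|\<Lambda>. ?p \<theta>)"
      using gauss_power_mixture(2)[OF fin sets S.m1 is_testD(1,2)[OF t], of "\<lambda>_. 1" 1]
      by (simp add: weighted_average_power_def mix_density_eq m1_def)
    also have "\<dots> = (LINT \<theta>|\<Lambda>. indicator U \<theta> * ?p \<theta> + indicator (- U) \<theta> * ?p \<theta>)"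
      by (intro Bochner_Integration.integral_cong) (auto simp: indicator_def)
    also have "\<dots> = (LINT \<theta>|\<Lambda>. indicator U \<theta> * ?p \<theta>) + (LINT \<theta>|\<Lambda>. indicator (- U) \<theta> * ?p \<theta>)"
      using U sets by (intro Bochner_Integration.integral_add int) auto
    also have "(LINT \<theta>|\<Lambda>. indicator U \<theta> * ?p \<theta>) = S.avg_power \<phi>"
    proof -
      have Ld: "L = density \<Lambda> (\<lambda>\<theta>. ennreal (indicator U \<theta>))" by (simp only: L_def ennreal_indicator)
      show ?thesis
        unfolding S.avg_power_def by (subst Ld, subst integral_density) (use p U in auto)
    qed
    also have "(LINT \<theta>|\<Lambda>. indicator (- U) \<theta> * ?p \<theta>) = d"
      unfolding d_def
    proof (rule integral_cong_AE)
      show "AE \<theta> in \<Lambda>. indicator (- U) \<theta> * ?p \<theta> = indicator (- U) \<theta> * \<alpha>"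
        using assms(10)
      proof (elim disjE conjE)
        assume lp: "\<beta>0 islimpt B"
        from AE show ?thesis
        proof eventually_elim
          case (elim \<theta>)
          then have "?p (\<beta>0, snd \<theta>) = \<alpha>"
            using power_null_eq_if_limit_point[OF _ lp, of \<Sigma> \<alpha> P \<phi> "snd \<theta>"] u unb by (auto simp: m1_def)
          then show ?case by (cases \<theta>) (auto simp: indicator_def U_def)
        qed
      next
        assume "emeasure \<Lambda> ({\<beta>0} \<times> P) = 0"
        moreover have "{\<beta>0} \<times> P \<in> sets \<Lambda>"
          using assms(5) unfolding sets by (intro borel_closed closed_Times) (auto simp: compact_imp_closed)
        ultimately have "AE \<theta> in \<Lambda>. \<theta> \<notin> {\<beta>0} \<times> P" by (intro AE_not_in) (simp add: null_sets_def)
        with AE show ?thesis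
          by eventually_elim (auto simp: indicator_def U_def)
      qed
    qed (use p U sets in auto)
    finally show ?thesis .
  qed
  have opt: "WAP_unbiased_test \<Sigma> \<beta>0 \<alpha> B P \<Lambda> \<phi> \<longleftrightarrow> S.optimal \<phi>" for \<phi>
    unfolding WAP_unbiased_test_def S.optimal_def unb using wap by auto
  have bayes_adm: "(\<exists>\<phi>s. (\<forall>m. bayes_test \<Sigma> \<beta>0 B P (\<phi>s m)) \<and> weak_star_converges \<phi>s \<phi>) \<and>
      admissible_test \<Sigma> \<beta>0 B P \<phi>" if \<phi>: "S.optimal \<phi>" for \<phi>
  proof -
    have u: "S.unbiased \<phi>" and t: "is_test \<phi>" using \<phi> by (auto simp: S.optimal_def S.unbiased_def)
    show ?thesis
    proof (cases "P = {0}")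
      \<comment> \<open>All the distributions of the model coincide.\<close>
      case True
      have "bayes_test \<Sigma> \<beta>0 B P \<phi>" using point_mass_null_bayes[OF t \<beta>1] True by simp
      moreover have "m1 (\<beta>, 0) = 0" for \<beta> by (simp add: m1_def model_mean_def zero_prod_def)
      then have "admissible_test \<Sigma> \<beta>0 B P \<phi>"
        unfolding admissible_test_def pow True using t \<beta>1 by (auto intro: antisym simp: not_less)
      moreover have "weak_star_converges (\<lambda>_. \<phi>) \<phi>" by (simp add: weak_star_converges_def)
      ultimately show ?thesis by (intro conjI exI[of _ "\<lambda>_. \<phi>"]) simp_all
    next
      case False
      then obtain \<mu> where \<mu>: "\<mu> \<in> P" "\<mu> \<noteq> 0" using assms(8) by blast
      \<comment> \<open>The first component of the mean vanishes on the null; this direction detects it on the alternative.\<close>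
      let ?v = "(C_mat \<Sigma> \<beta>0 *v \<mu>, 0 :: real^'k)"
      have C\<mu>: "C_mat \<Sigma> \<beta>0 *v \<mu> \<noteq> 0" using C_mat_injective[OF assms(3)] \<mu>(2) by blast
      have uniq: "AE x in lborel. \<psi> x = \<phi> x" if "S.optimal \<psi>" for \<psi>
      proof (rule S.optimal_unique[OF _ _ _ that \<phi>])
        show "m0 \<theta> \<bullet> ?v = 0" for \<theta> by (simp add: m0_def m1_def model_mean_def)
        show "(\<beta>1, \<mu>) \<in> A" using \<beta>1 \<mu> by (simp add: A_def)
        show "m1 (\<beta>1, \<mu>) \<bullet> ?v \<noteq> 0" using \<beta>1 C\<mu> by (simp add: m1_def model_mean_def)
      qed
      have "\<forall>n. \<exists>\<psi>. is_test \<psi> \<and> (\<forall>u. is_test u \<longrightarrow> S.penalised (real (Suc n)) u \<le> S.penalised (real (Suc n)) \<psi>) \<and>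
        bayes_test \<Sigma> \<beta>0 B P \<psi>"
      proof
        fix n
        let ?c = "real (Suc n)"
        have c: "?c > 0" by simp
        obtain \<psi> where \<psi>: "is_test \<psi>" "\<And>u. is_test u \<Longrightarrow> S.penalised ?c u \<le> S.penalised ?c \<psi>"
            "\<And>x. S.null_mix ?c \<psi> x < S.alt_mix ?c \<psi> x \<Longrightarrow> \<psi> x = 1"
            "\<And>x. S.alt_mix ?c \<psi> x < S.null_mix ?c \<psi> x \<Longrightarrow> \<psi> x = 0"
            "0 < (LINT \<theta>|L. S.excess \<psi> \<theta>)"
          using S.bayes_penalised_maximiser_exists[OF c] by blast
        have "bayes_test \<Sigma> \<beta>0 B P \<psi>"
        proof (rule weighted_mixtures_bayes[OF S.L S.sets_L S.AE_A[unfolded A_def] _ \<psi>(1)])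
          show "P \<in> sets borel" using assms(5) by (intro borel_closed compact_imp_closed)
          show "(\<lambda>\<theta>. 1 + ?c * S.shortfall \<psi> \<theta>) \<in> borel_measurable borel"
            "(\<lambda>\<theta>. ?c * S.excess \<psi> \<theta>) \<in> borel_measurable borel"
            using S.measurable_violation[OF \<psi>(1)] by auto
          fix \<theta>
          have "?c * S.shortfall \<psi> \<theta> \<le> ?c * 1" "?c * S.excess \<psi> \<theta> \<le> ?c * 1"
            "0 \<le> ?c * S.shortfall \<psi> \<theta>" "0 \<le> ?c * S.excess \<psi> \<theta>"
            using S.violation_bounds[OF \<psi>(1)] by (intro mult_left_mono mult_nonneg_nonneg; simp)+
          then show "0 \<le> 1 + ?c * S.shortfall \<psi> \<theta>" "1 + ?c * S.shortfall \<psi> \<theta> \<le> 1 + ?c"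
            "0 \<le> ?c * S.excess \<psi> \<theta>" "?c * S.excess \<psi> \<theta> \<le> 1 + ?c"
            unfolding mult_1_right by linarith+
        next
          have "integrable L (S.shortfall \<psi>)"
            using S.violation_bounds[OF \<psi>(1)] S.measurable_violation[OF \<psi>(1)]
            by (intro S.integrable_bounded_L[of _ 1]) auto
          moreover have "0 \<le> (LINT \<theta>|L. S.shortfall \<psi> \<theta>)"
            by (intro integral_nonneg_AE AE_I2 S.violation_bounds \<psi>(1))
          moreover have "0 < measure L (space L)"
            using S.L_nonzero by (simp add: S.L.emeasure_eq_measure zero_less_measure_iff)
          ultimately show "0 < (LINT \<theta>|L. 1 + ?c * S.shortfall \<psi> \<theta>)"
            by (simp add: add_pos_nonneg)
          show "0 < (LINT \<theta>|L. ?c * S.excess \<psi> \<theta>)" using \<psi>(5) by simp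
          fix x
          show "\<psi> x = 1"
            if "(LINT \<theta>|L. ?c * S.excess \<psi> \<theta> * gauss (model_mean \<Sigma> \<beta>0 (\<beta>0, snd \<theta>)) x)
              < (LINT \<theta>|L. (1 + ?c * S.shortfall \<psi> \<theta>) * gauss (model_mean \<Sigma> \<beta>0 \<theta>) x)"
            using \<psi>(3)[of x] that
            unfolding S.alt_mix_def S.null_mix_def m0_def m1_def[symmetric] by blast
          show "\<psi> x = 0"
            if "(LINT \<theta>|L. (1 + ?c * S.shortfall \<psi> \<theta>) * gauss (model_mean \<Sigma> \<beta>0 \<theta>) x)
              < (LINT \<theta>|L. ?c * S.excess \<psi> \<theta> * gauss (model_mean \<Sigma> \<beta>0 (\<beta>0, snd \<theta>)) x)"
            using \<psi>(4)[of x] that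
            unfolding S.alt_mix_def S.null_mix_def m0_def m1_def[symmetric] by blast
        qed
        then show "\<exists>\<psi>. is_test \<psi> \<and> (\<forall>u. is_test u \<longrightarrow> S.penalised ?c u \<le> S.penalised ?c \<psi>) \<and> bayes_test \<Sigma> \<beta>0 B P \<psi>"
          using \<psi>(1,2) by blast
      qed
      then obtain \<psi> where \<psi>: "\<And>n. is_test (\<psi> n)"
          "\<And>n u. is_test u \<Longrightarrow> S.penalised (real (Suc n)) u \<le> S.penalised (real (Suc n)) (\<psi> n)"
          "\<And>n. bayes_test \<Sigma> \<beta>0 B P (\<psi> n)"
        by metis
      have "weak_star_converges \<psi> \<phi>" by (rule S.penalised_maximisers_converge[OF \<phi> uniq \<psi>(1,2)])
      \<comment> \<open>A dominating test is itself optimal, so by uniqueness it has the same powers.\<close>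
      moreover have "admissible_test \<Sigma> \<beta>0 B P \<phi>"
        unfolding admissible_test_def pow
      proof (intro conjI t notI, elim exE conjE)
        fix \<psi>
        assume t\<psi>: "is_test \<psi>"
          and le: "\<forall>\<mu>\<in>P. gauss_power \<psi> (m1 (\<beta>0, \<mu>)) \<le> gauss_power \<phi> (m1 (\<beta>0, \<mu>))"
          and ge: "\<forall>\<beta>\<in>B. \<forall>\<mu>\<in>P. \<beta> \<noteq> \<beta>0 \<longrightarrow> gauss_power \<phi> (m1 (\<beta>, \<mu>)) \<le> gauss_power \<psi> (m1 (\<beta>, \<mu>))"
          and strict: "(\<exists>\<mu>\<in>P. gauss_power \<psi> (m1 (\<beta>0, \<mu>)) < gauss_power \<phi> (m1 (\<beta>0, \<mu>))) \<or>
            (\<exists>\<beta>\<in>B. \<exists>\<mu>\<in>P. \<beta> \<noteq> \<beta>0 \<and> gauss_power \<phi> (m1 (\<beta>, \<mu>)) < gauss_power \<psi> (m1 (\<beta>, \<mu>)))"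
        have "S.unbiased \<psi>"
          unfolding S.unbiased_def
        proof (intro conjI ballI t\<psi>)
          fix \<theta> assume \<theta>: "\<theta> \<in> A"
          then have "gauss_power \<psi> (m0 \<theta>) \<le> gauss_power \<phi> (m0 \<theta>)" "gauss_power \<phi> (m1 \<theta>) \<le> gauss_power \<psi> (m1 \<theta>)"
            using le ge by (auto simp: A_def m0_def)
          then show "gauss_power \<psi> (m0 \<theta>) \<le> \<alpha>" "\<alpha> \<le> gauss_power \<psi> (m1 \<theta>)"
            using u \<theta> by (fastforce simp: S.unbiased_def)+
        qed
        moreover have "S.avg_power \<phi> \<le> S.avg_power \<psi>"
          unfolding S.avg_power_def
        proof (rule integral_mono_AE[OF S.integrable_power(2)[OF t] S.integrable_power(2)[OF t\<psi>]])
          show "AE \<theta> in L. gauss_power \<phi> (m1 \<theta>) \<le> gauss_power \<psi> (m1 \<theta>)"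
            using S.AE_A by eventually_elim (use ge in \<open>auto simp: A_def\<close>)
        qed
        ultimately have "S.optimal \<psi>" using \<phi> by (fastforce simp: S.optimal_def)
        then have "gauss_power \<psi> m = gauss_power \<phi> m" for m
          using gauss_power_cong_AE[OF is_testD(1)[OF t\<psi>] is_testD(1)[OF t]] uniq by blast
        then show False using strict by simp
      qed
      ultimately show ?thesis using \<psi>(3) by blast
    qed
  qed
  show ?thesis unfolding opt using S.optimal_exists bayes_adm by blast
qed

end
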